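(* Let $\phi$ be a stationary solution, i.e. $\phi\in X^2(\mathbb{R})$ and $$\phi_{xx}+i\phi^2\,\overline{\phi}_x=0\quad\text{on }\mathbb{R}.$$ Assume that $\phi$ is not a constant function and satisfies $m:=\inf_{x\in\mathbb{R}}|\phi(x)|>0$. Then $\phi$ is of the form $\phi=e^{i\theta}\sqrt{k}$, where $$k(x)=2\sqrt{B}+\frac{-1}{\sqrt{\frac{5}{72B}}\cosh(2\sqrt{B}\,x)+\frac{5}{12\sqrt{B}}},\qquad \theta(x)=\theta_0-\int_x^{\infty}\left(\frac{B}{k(y)}-\frac{k(y)}{4}\right)dy,$$ for some constants $\theta_0\in\mathbb{R}$ and $B>0$. Moreover, if $\phi$ is a stationary solution (i.e. $\phi\in X^2(\mathbb{R})$ and $\phi_{xx}+i\phi^2\,\overline{\phi}_x=0$ on $\mathbb{R}$) such that $\phi(\infty)=0$, i.e. $\lim_{x\to+\infty}\phi(x)=0$, then $\phi\equiv0$ on $\mathbb{R}$.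
   Context: For an integer $k\ge 1$, the Zhidkov space is $X^k(\mathbb{R})=\{u\in L^\infty(\mathbb{R}):\partial_x u\in H^{k-1}(\mathbb{R})\}$ (complex-valued functions). The equation $\phi_{xx}+i\phi^2\,\overline{\phi}_x=0$ is the stationary form of $i\partial_t u+\partial_x^2u=-iu^2\partial_x\overline{u}$.
   Formalization: The form of φ is proved up to translation: φ(x)=e^{iθ(x−x₀)}√k(x−x₀) for some real x₀; without the shift the claim is false, since translates of a solution are solutions but every displayed k has its unique minimum at x=0. *)

theory Defs
  imports "HOL-Analysis.Analysis"
begin

definition test_function :: "(real \<Rightarrow> real) \<Rightarrow> bool" where
  "test_function \<eta> \<longleftrightarrow>
     (\<forall>n x. (deriv ^^ n) \<eta> field_differentiable at x) \<and> compact (closure {x. \<eta> x \<noteq> 0})"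

definition locally_integrable :: "(real \<Rightarrow> complex) \<Rightarrow> bool" where
  "locally_integrable u \<longleftrightarrow> (\<forall>a b. u absolutely_integrable_on {a..b})"

(* Real-valued test functions suffice: the identity is complex linear in the test function. *)
definition has_weak_derivative :: "(real \<Rightarrow> complex) \<Rightarrow> (real \<Rightarrow> complex) \<Rightarrow> bool" where
  "has_weak_derivative u v \<longleftrightarrow> locally_integrable u \<and> locally_integrable v \<and>
     (\<forall>\<eta>. test_function \<eta> \<longrightarrow>
        (LINT x|lebesgue. deriv \<eta> x *\<^sub>R u x) = - (LINT x|lebesgue. \<eta> x *\<^sub>R v x))"

definition L2_space :: "(real \<Rightarrow> complex) set" where
  "L2_space = {u \<in> borel_measurable lebesgue. integrable lebesgue (\<lambda>x. (norm (u x))\<^sup>2)}"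

definition Linf_space :: "(real \<Rightarrow> complex) set" where
  "Linf_space = {u \<in> borel_measurable lebesgue. \<exists>C. AE x in lebesgue. norm (u x) \<le> C}"

fun sobolev_H :: "nat \<Rightarrow> (real \<Rightarrow> complex) set" where
  "sobolev_H 0 = L2_space"
| "sobolev_H (Suc k) = {u \<in> L2_space. \<exists>v \<in> sobolev_H k. has_weak_derivative u v}"

(* Only meant for k >= 1.  Each class modulo null sets in the Zhidkov space then has exactly
   one continuous representative; since pointwise values of the elements are used, the space
   is taken to consist of these representatives. *)
definition zhidkov :: "nat \<Rightarrow> (real \<Rightarrow> complex) set" where
  "zhidkov k = {u \<in> Linf_space. continuous_on UNIV u \<and>
                  (\<exists>v \<in> sobolev_H (k - 1). has_weak_derivative u v)}"

(* For \<phi> in zhidkov 2 the weak derivatives exist as functions and are unique up to null sets. *)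
definition stationary_solution :: "(real \<Rightarrow> complex) \<Rightarrow> bool" where
  "stationary_solution \<phi> \<longleftrightarrow> \<phi> \<in> zhidkov 2 \<and>
     (\<exists>\<phi>x \<phi>xx. has_weak_derivative \<phi> \<phi>x \<and> has_weak_derivative \<phi>x \<phi>xx \<and>
        (AE x in lebesgue. \<phi>xx x + \<i> * (\<phi> x)\<^sup>2 * cnj (\<phi>x x) = 0))"

(* The profile is centred at its minimum 0.  The equation is translation invariant, so a
   solution can only be identified with this profile up to a shift of x. *)
definition k_profile :: "real \<Rightarrow> real \<Rightarrow> real" where
  "k_profile B x = 2 * sqrt B +
     (- 1) / (sqrt (5 / (72 * B)) * cosh (2 * sqrt B * x) + 5 / (12 * sqrt B))"

definition theta_profile :: "real \<Rightarrow> real \<Rightarrow> real \<Rightarrow> real" where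
  "theta_profile B \<theta>0 x =
     \<theta>0 - (LINT y:{x..}|lebesgue. B / k_profile B y - k_profile B y / 4)"

text \<open>The profiles are well defined: the square root is taken of a positive number and the
  integral over the half-line converges absolutely.\<close>

lemma k_profile_bounds:
  assumes "B > 0"
  shows "k_profile B x \<ge> sqrt B / 2"
    and "\<bar>k_profile B x - 2 * sqrt B\<bar> \<le> 2 / sqrt (5 / (72 * B)) * exp (- (2 * sqrt B) * x)"
proof -
  define s where "s = sqrt B"
  define A where "A = sqrt (5 / (72 * B))"
  define D where "D = A * cosh (2 * s * x) + 5 / (12 * s)"
  have s: "s > 0" "B = s\<^sup>2" using assms by (auto simp: s_def)
  have A: "A > 0" using assms by (simp add: A_def)
  have "1 / (4 * s) \<le> A"
    unfolding A_def by (rule real_le_rsqrt) (use s in \<open>simp add: power2_eq_square field_simps\<close>)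
  moreover have "A * 1 \<le> A * cosh (2 * s * x)"
    using A by (intro mult_left_mono cosh_real_ge_1) auto
  moreover have "1 / (4 * s) + 5 / (12 * s) = 2 / (3 * s)" using s by (simp add: field_simps)
  ultimately have D: "D \<ge> 2 / (3 * s)" unfolding D_def by linarith
  have D0: "D > 0" using D s by (meson divide_pos_pos less_le_trans mult_pos_pos zero_less_numeral)
  have "1 / D \<le> 1 / (2 / (3 * s))" using D s(1) D0 by (intro divide_left_mono) auto
  hence "1 / D \<le> 3 * s / 2" by simp
  moreover have k: "k_profile B x = 2 * s - 1 / D"
    by (simp add: k_profile_def D_def A_def s_def)
  ultimately show "k_profile B x \<ge> sqrt B / 2" by (simp add: s_def)
  have "exp (2 * s * x) / 2 \<le> cosh (2 * s * x)"
    by (simp add: cosh_def)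
  hence "A * (exp (2 * s * x) / 2) \<le> A * cosh (2 * s * x)" using A by (intro mult_left_mono) auto
  moreover have "5 / (12 * s) > 0" using s by simp
  ultimately have "A * (exp (2 * s * x) / 2) \<le> D" unfolding D_def by linarith
  hence "1 / D \<le> 1 / (A * (exp (2 * s * x) / 2))"
    using A D0 by (intro divide_left_mono) auto
  also have "\<dots> = 2 / A * exp (- (2 * s) * x)" by (simp add: exp_minus field_simps)
  finally show "\<bar>k_profile B x - 2 * sqrt B\<bar> \<le> 2 / sqrt (5 / (72 * B)) * exp (- (2 * sqrt B) * x)"
    using k D0 by (simp add: s_def A_def)
qed

lemma theta_profile_integrand_integrable:
  assumes "B > 0"
  shows "(\<lambda>y. B / k_profile B y - k_profile B y / 4) absolutely_integrable_on {x..}"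
proof (rule measurable_bounded_by_integrable_imp_absolutely_integrable)
  define s where "s = sqrt B"
  define A where "A = sqrt (5 / (72 * B))"
  let ?g = "\<lambda>y. (2 / A) * exp (- (2 * s) * y)"
  have s: "s > 0" "B = s\<^sup>2" using assms by (auto simp: s_def)
  have cont: "continuous_on {x..} (\<lambda>y. k_profile B y)"
    unfolding k_profile_def
  proof (intro continuous_intros ballI)
    fix y
    have "sqrt (5 / (72 * B)) * cosh (2 * sqrt B * y) > 0"
      using assms by (intro mult_pos_pos cosh_real_pos) auto
    moreover have "5 / (12 * sqrt B) > 0" using assms by simp
    ultimately show "sqrt (5 / (72 * B)) * cosh (2 * sqrt B * y) + 5 / (12 * sqrt B) \<noteq> 0"
      by linarith
  qed
  have "k_profile B y \<noteq> 0" for y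
    using k_profile_bounds(1)[OF assms, of y] s(1) unfolding s_def by linarith
  hence "continuous_on {x..} (\<lambda>y. B / k_profile B y - k_profile B y / 4)"
    using cont by (intro continuous_on_diff continuous_on_divide continuous_on_const) auto
  thus "(\<lambda>y. B / k_profile B y - k_profile B y / 4) \<in> borel_measurable (lebesgue_on {x..})"
    by (rule continuous_imp_measurable_on_sets_lebesgue) simp
  show "{x..} \<in> sets lebesgue" by simp
  show "(\<lambda>y. ?g y * 2) integrable_on {x..}"
    using has_integral_exp_minus_to_infinity[of "2 * s" x] s
    by (intro integrable_on_mult_left integrable_on_mult_right) (auto simp: integrable_on_def)
  fix y
  define k where "k = k_profile B y"
  have k: "k \<ge> s / 2" "\<bar>k - 2 * s\<bar> \<le> ?g y"
    using k_profile_bounds[OF assms, of y] by (auto simp: k_def s_def A_def)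
  have k0: "k > 0" using k s by linarith
  have "B / k - k / 4 = (2 * s - k) * ((2 * s + k) / (4 * k))"
    using k0 unfolding s(2) by (simp add: divide_simps) algebra
  hence "\<bar>B / k - k / 4\<bar> = \<bar>k - 2 * s\<bar> * ((2 * s + k) / (4 * k))"
    using k0 s by (simp add: abs_mult)
  also have "\<dots> \<le> \<bar>k - 2 * s\<bar> * 2"
    using k k0 by (intro mult_left_mono) (auto simp: field_simps)
  also have "\<dots> \<le> ?g y * 2" using k(2) by simp
  finally show "norm (B / k_profile B y - k_profile B y / 4) \<le> ?g y * 2" by (simp add: k_def)
qed

end

theory Submission
  imports Defs "HOL-Computational_Algebra.Polynomial"
begin

text \<open>Testing the weak equation against smoothed indicator functions of intervals shows that
  \<open>\<phi>\<close> is twice differentiable. Write \<open>k = |\<phi>|\<^sup>2\<close> and \<open>J = Im (cnj \<phi> * \<phi>')\<close>. Then \<open>J + k\<^sup>2 / 4 = B\<close> and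
  \<open>|\<phi>'|\<^sup>2 = k\<^sup>3 / 6 - 2 * B * k + E0\<close> for constants \<open>B\<close> and \<open>E0\<close>, and \<open>k'\<^sup>2 / 4 = k * |\<phi>'|\<^sup>2 - J\<^sup>2\<close> turns these into a
  first-order equation for \<open>k\<close>. Since \<open>\<phi>'\<close> is square integrable, it tends to zero along a sequence,
  which determines \<open>E0\<close> in terms of \<open>B\<close>. If \<open>|\<phi>|\<close> is bounded below, then \<open>2 * sqrt B\<close> is a double root
  of the quartic in \<open>k\<close>, and \<open>1 / (2 * sqrt B - k)\<close> solves a linear equation whose solutions are
  hyperbolic cosines; the phase is recovered from \<open>J = k * \<theta>'\<close>. If \<open>\<phi>\<close> tends to zero, then \<open>B = E0 = 0\<close>
  and \<open>1 / k\<close> would be a nonconstant affine function without zeros.\<close>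

subsection \<open>A smooth step function\<close>

text \<open>The regularity half of \<open>test_function\<close>. It is kept apart from the support
  condition because the step function from which test functions are built has unbounded
  support.\<close>

definition smooth :: "(real \<Rightarrow> real) \<Rightarrow> bool" where
  "smooth f \<longleftrightarrow> (\<forall>n x. (deriv ^^ n) f field_differentiable at x)"

text \<open>A family that contains the derivatives of its members contains all iterated derivatives.
  Smoothness thus reduces to finding one such family around \<open>f\<close>, without counting
  derivatives.\<close>

lemma smooth_coinduct:
  assumes "f \<in> F"
    and diff: "\<And>g x. g \<in> F \<Longrightarrow> g field_differentiable at x"
    and deriv: "\<And>g. g \<in> F \<Longrightarrow> deriv g \<in> F"
  shows "smooth f"
proof -
  have "(deriv ^^ n) f \<in> F" for n
    by (induction n) (use assms in auto)
  thus ?thesis using diff by (auto simp: smooth_def)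
qed

lemma smooth_deriv: "smooth f \<Longrightarrow> smooth (deriv f)"
  unfolding smooth_def by (metis comp_apply funpow_Suc_right)

lemma smooth_has_real_derivative:
  "smooth f \<Longrightarrow> (f has_real_derivative deriv f x) (at x)"
  unfolding smooth_def by (metis DERIV_deriv_iff_field_differentiable funpow_0)

lemma smooth_continuous: "smooth f \<Longrightarrow> continuous_on A f"
  by (meson DERIV_continuous continuous_at_imp_continuous_on smooth_has_real_derivative)

text \<open>Iterated derivatives of products and reciprocals have no convenient closed form. Closing
  the smooth functions under these operations gives a family invariant under differentiation, to
  which \<open>smooth_coinduct\<close> applies.\<close>

inductive_set smooth_closure :: "(real \<Rightarrow> real) set" where
  base: "smooth f \<Longrightarrow> f \<in> smooth_closure"
| add: "f \<in> smooth_closure \<Longrightarrow> g \<in> smooth_closure \<Longrightarrow> (\<lambda>x. f x + g x) \<in> smooth_closure"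
| mult: "f \<in> smooth_closure \<Longrightarrow> g \<in> smooth_closure \<Longrightarrow> (\<lambda>x. f x * g x) \<in> smooth_closure"
| inverse: "f \<in> smooth_closure \<Longrightarrow> (\<And>x. f x \<noteq> 0) \<Longrightarrow> (\<lambda>x. inverse (f x)) \<in> smooth_closure"

lemma smooth_const: "smooth (\<lambda>x. c)"
  by (rule smooth_coinduct[where F = "range (\<lambda>c x. c)"]) auto

lemma smooth_closure_deriv:
  assumes "f \<in> smooth_closure"
  shows "\<exists>f' \<in> smooth_closure. \<forall>x. (f has_real_derivative f' x) (at x)"
  using assms
proof induction
  case (base f)
  thus ?case using smooth_closure.base smooth_deriv smooth_has_real_derivative by blast
next
  case (add f g)
  then obtain f' g' where "f' \<in> smooth_closure" "g' \<in> smooth_closure"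
    "\<forall>x. (f has_real_derivative f' x) (at x)" "\<forall>x. (g has_real_derivative g' x) (at x)" by auto
  thus ?case
    by (intro bexI[of _ "\<lambda>x. f' x + g' x"]) (auto intro!: derivative_intros smooth_closure.add)
next
  case (mult f g)
  then obtain f' g' where "f' \<in> smooth_closure" "g' \<in> smooth_closure"
    "\<forall>x. (f has_real_derivative f' x) (at x)" "\<forall>x. (g has_real_derivative g' x) (at x)" by auto
  thus ?case using mult.hyps
    by (intro bexI[of _ "\<lambda>x. f' x * g x + g' x * f x"] allI DERIV_mult)
       (auto intro!: smooth_closure.add smooth_closure.mult)
next
  case (inverse f)
  then obtain f' where f': "f' \<in> smooth_closure" "\<forall>x. (f has_real_derivative f' x) (at x)" by auto
  \<comment> \<open>The derivative is spelled as a product of members, as the closure has no rule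
    for quotients or negation.\<close>
  have "((\<lambda>x. inverse (f x)) has_real_derivative (- 1) * (inverse (f x) * f' x * inverse (f x))) (at x)" for x
    using f'(2) inverse.hyps by (auto intro!: derivative_eq_intros)
  moreover have "(\<lambda>x. (- 1) * (inverse (f x) * f' x * inverse (f x))) \<in> smooth_closure"
    using inverse.hyps f'(1)
    by (intro smooth_closure.mult smooth_closure.inverse inverse.hyps smooth_closure.base[OF smooth_const])
  ultimately show ?case
    by (intro bexI[of _ "\<lambda>x. (- 1) * (inverse (f x) * f' x * inverse (f x))"] allI)
qed

lemma smooth_if_smooth_closure:
  assumes "f \<in> smooth_closure"
  shows "smooth f"
proof (rule smooth_coinduct[OF assms])
  fix g x assume "g \<in> smooth_closure"
  then obtain g' where g': "g' \<in> smooth_closure" "\<forall>x. (g has_real_derivative g' x) (at x)"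
    using smooth_closure_deriv by blast
  thus "g field_differentiable at x" by (auto simp: field_differentiable_def)
next
  fix g assume "g \<in> smooth_closure"
  then obtain g' where g': "g' \<in> smooth_closure" "\<forall>x. (g has_real_derivative g' x) (at x)"
    using smooth_closure_deriv by blast
  moreover from this have "deriv g = g'" by (auto intro: DERIV_imp_deriv)
  ultimately show "deriv g \<in> smooth_closure" by simp
qed

lemma smooth_add: "smooth f \<Longrightarrow> smooth g \<Longrightarrow> smooth (\<lambda>x. f x + g x)"
  and smooth_mult: "smooth f \<Longrightarrow> smooth g \<Longrightarrow> smooth (\<lambda>x. f x * g x)"
  and smooth_inverse: "smooth f \<Longrightarrow> (\<And>x. f x \<noteq> 0) \<Longrightarrow> smooth (\<lambda>x. inverse (f x))"
  by (blast intro: smooth_if_smooth_closure[OF smooth_closure.add, OF smooth_closure.base smooth_closure.base]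
      smooth_if_smooth_closure[OF smooth_closure.mult, OF smooth_closure.base smooth_closure.base]
      smooth_if_smooth_closure[OF smooth_closure.inverse, OF smooth_closure.base])+

lemma smooth_diff: "smooth f \<Longrightarrow> smooth g \<Longrightarrow> smooth (\<lambda>x. f x - g x)"
  using smooth_add[of f "\<lambda>x. (- 1) * g x"] smooth_mult[of "\<lambda>_. - 1" g] smooth_const[of "- 1"] by simp

lemma DERIV_affine:
  assumes "smooth f"
  shows "((\<lambda>x. f (a * x + b)) has_real_derivative a * deriv f (a * x + b)) (at x)"
proof -
  have "((\<lambda>x. a * x + b) has_real_derivative a) (at x)"
    by (auto intro!: derivative_eq_intros)
  from DERIV_chain2[OF smooth_has_real_derivative[OF assms] this] show ?thesis
    by (simp add: mult.commute)
qed

lemma smooth_affine: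
  assumes "smooth f"
  shows "smooth (\<lambda>x. f (a * x + b))"
\<comment> \<open>Each differentiation produces a factor \<open>a\<close>, so the invariant family
  has to allow a scalar \<open>c\<close>.\<close>
proof (rule smooth_coinduct[where F = "{\<lambda>x. c * g (a * x + b) | c g. smooth g}"])
  show "(\<lambda>x. f (a * x + b)) \<in> {\<lambda>x. c * g (a * x + b) | c g. smooth g}"
    using assms by (auto intro!: exI[of _ 1])
next
  fix h x assume "h \<in> {\<lambda>x. c * g (a * x + b) | c g. smooth g}"
  then obtain c g where h: "h = (\<lambda>x. c * g (a * x + b))" and g: "smooth g" by blast
  show "h field_differentiable at x"
    unfolding field_differentiable_def h using DERIV_cmult[OF DERIV_affine[OF g]] by blast
next
  fix h assume "h \<in> {\<lambda>x. c * g (a * x + b) | c g. smooth g}"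
  then obtain c g where h: "h = (\<lambda>x. c * g (a * x + b))" and g: "smooth g" by blast
  have "deriv h = (\<lambda>x. (c * a) * deriv g (a * x + b))"
    unfolding h using DERIV_imp_deriv[OF DERIV_cmult[OF DERIV_affine[OF g]]] by (auto simp: mult.assoc)
  thus "deriv h \<in> {\<lambda>x. c * g (a * x + b) | c g. smooth g}" using smooth_deriv[OF g] by blast
qed

section \<open>Functions flat at the origin\<close>

lemma tendsto_power_poly_div_exp_0:
  fixes p :: "real poly"
  shows "((\<lambda>t. t ^ k * poly p t / exp t) \<longlongrightarrow> 0) at_top"
\<comment> \<open>Splitting \<open>pCons a p\<close> moves one factor \<open>t\<close> into the
  power, so the exponent has to vary.\<close>
proof (induction p arbitrary: k)
  case 0
  show ?case by simp
next
  case (pCons a p)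
  have "((\<lambda>t. a * (t ^ k / exp t) + t ^ Suc k * poly p t / exp t) \<longlongrightarrow> a * 0 + 0) at_top"
    by (intro tendsto_intros pCons.IH tendsto_power_div_exp_0)
  thus ?case by (simp add: algebra_simps add_divide_distrib)
qed

text \<open>This family of functions is closed under differentiation, which makes each member smooth.\<close>

definition flat :: "real poly \<Rightarrow> real \<Rightarrow> real" where
  "flat p x = (if x > 0 then poly p (inverse x) / exp (inverse x) else 0)"

text \<open>Put y = 1/x, so that d/dx is -y^2 times d/dy. Since p(y) exp(-y) has y-derivative (p'(y)
  - p(y)) exp(-y), the new polynomial is y^2 (p - p'). At the origin the right difference quotient
  is y p(y) exp(-y), which tends to zero as y grows.\<close>

lemma flat_deriv:
  "(flat p has_real_derivative flat (monom 1 2 * (p - pderiv p)) x) (at x)"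
proof -
  consider "x > 0" | "x < 0" | "x = 0" by linarith
  thus ?thesis
  proof cases
    case 1
    have "((\<lambda>x. poly p (inverse x) / exp (inverse x)) has_real_derivative
            flat (monom 1 2 * (p - pderiv p)) x) (at x)"
      using 1 by (auto intro!: derivative_eq_intros simp: flat_def poly_monom power2_eq_square)
                 (simp add: field_simps)
    moreover have "\<forall>\<^sub>F y in nhds x. flat p y = poly p (inverse y) / exp (inverse y)"
      using eventually_nhds_in_open[of "{0<..}" x] 1
      by (auto elim!: eventually_mono simp: flat_def)
    ultimately show ?thesis by (simp add: DERIV_cong_ev)
  next
    case 2
    have "\<forall>\<^sub>F y in nhds x. flat p y = 0"
      using eventually_nhds_in_open[of "{..<0}" x] 2
      by (auto elim!: eventually_mono simp: flat_def)
    thus ?thesis using 2 by (simp add: DERIV_cong_ev flat_def)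
  next
    case 3
    have "((\<lambda>x. flat p x / x) \<longlongrightarrow> 0) (at_left 0)"
      by (rule tendsto_eventually) (auto simp: eventually_at_filter flat_def)
    moreover have "((\<lambda>x. flat p x / x) \<longlongrightarrow> 0) (at_right 0)"
    proof -
      have "((\<lambda>x. (inverse x) ^ 1 * poly p (inverse x) / exp (inverse x)) \<longlongrightarrow> 0) (at_right 0)"
        using tendsto_power_poly_div_exp_0[of 1 p] filterlim_inverse_at_top_right
        by (rule filterlim_compose)
      moreover have "\<forall>\<^sub>F x in at_right 0. (inverse x) ^ 1 * poly p (inverse x) / exp (inverse x) = flat p x / x"
        by (auto simp: eventually_at_filter flat_def divide_inverse)
      ultimately show ?thesis by (rule Lim_transform_eventually)
    qed
    ultimately have "((\<lambda>x. flat p x / x) \<longlongrightarrow> 0) (at 0)" by (simp add: filterlim_split_at)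
    thus ?thesis using 3 by (simp add: has_field_derivative_iff flat_def)
  qed
qed

lemma smooth_flat: "smooth (flat p)"
proof (rule smooth_coinduct[where F = "range flat"])
  fix g x assume "g \<in> range flat"
  thus "g field_differentiable at x" using flat_deriv by (auto simp: field_differentiable_def)
next
  fix g assume "g \<in> range flat"
  then obtain q where "g = flat q" by blast
  moreover have "deriv (flat q) = flat (monom 1 2 * (q - pderiv q))" for q
    using DERIV_imp_deriv[OF flat_deriv] by auto
  ultimately show "deriv g \<in> range flat" by simp
qed auto

text \<open>\<open>flat 1\<close> is exp(-1/x) extended by zero. The denominator is positive because
  x and 1 - x are never both nonpositive, and the quotient is exactly constant on either side of the
  unit interval.\<close>

definition smooth_step :: "real \<Rightarrow> real" where
  "smooth_step x = flat 1 x * inverse (flat 1 x + flat 1 (1 - x))"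

lemma smooth_smooth_step: "smooth smooth_step"
proof -
  have "flat 1 x + flat 1 (1 - x) \<noteq> 0" for x
    using exp_gt_zero[of "inverse x"] exp_gt_zero[of "inverse (1 - x)"]
    by (auto simp: flat_def add_nonneg_eq_0_iff)
  moreover have "smooth (\<lambda>x. flat 1 (1 - x))" using smooth_affine[OF smooth_flat, of 1 "- 1" 1] by simp
  ultimately show ?thesis
    unfolding smooth_step_def[abs_def]
    by (intro smooth_mult smooth_inverse smooth_add smooth_flat)
qed

lemma smooth_step_bounds: "0 \<le> smooth_step x" "smooth_step x \<le> 1"
proof -
  have *: "flat 1 y \<ge> 0" for y by (simp add: flat_def)
  show "0 \<le> smooth_step x" using * by (simp add: smooth_step_def)
  show "smooth_step x \<le> 1" using *[of x] *[of "1 - x"]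
    unfolding smooth_step_def divide_inverse[symmetric] by (subst divide_le_eq_1) linarith
qed

lemma smooth_step_eq_0: "x \<le> 0 \<Longrightarrow> smooth_step x = 0"
  and smooth_step_eq_1: "x \<ge> 1 \<Longrightarrow> smooth_step x = 1"
  by (auto simp: smooth_step_def flat_def)

text \<open>To cover the end points as well, the difference quotient is taken on the side pointing
  away from the unit interval, where the step is constant.\<close>

lemma deriv_smooth_step_eq_0:
  assumes "x \<notin> {0<..<1}"
  shows "deriv smooth_step x = 0"
proof -
  have "((\<lambda>h. (smooth_step (x + h) - smooth_step x) / h) \<longlongrightarrow> deriv smooth_step x)
      (at 0 within (if x \<le> 0 then {..<0} else {0<..}))"
    using smooth_has_real_derivative[OF smooth_smooth_step, of x]
    by (auto simp: DERIV_def intro: filterlim_mono[OF _ order_refl at_le])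
  moreover have "((\<lambda>h. (smooth_step (x + h) - smooth_step x) / h) \<longlongrightarrow> 0)
      (at 0 within (if x \<le> 0 then {..<0} else {0<..}))"
    using assms by (intro tendsto_eventually)
      (auto simp: eventually_at_filter smooth_step_eq_0 smooth_step_eq_1)
  moreover have "at 0 within (if x \<le> 0 then {..<0} else {0<..}) \<noteq> (bot :: real filter)"
    by simp
  ultimately show ?thesis using tendsto_unique by blast
qed

subsection \<open>Weak derivatives on the line\<close>

lemma test_function_if_smooth:
  assumes "smooth f" "\<And>x. x \<notin> {a..b} \<Longrightarrow> f x = 0"
  shows "test_function f"
proof -
  have "closure {x. f x \<noteq> 0} \<subseteq> {a..b}"
    by (intro closure_minimal subsetI) (use assms(2) in blast, simp)
  hence "compact (closure {x. f x \<noteq> 0})"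
    using compact_closure bounded_subset[OF bounded_closed_interval[of a b]] closure_subset
    by (metis closed_closure compact_eq_bounded_closed)
  thus ?thesis using assms(1) by (simp add: test_function_def smooth_def)
qed

lemma lebesgue_integral_eq_integral_support:
  fixes F :: "real \<Rightarrow> complex"
  assumes "integrable lebesgue F" "\<And>x. x \<notin> {a..b} \<Longrightarrow> F x = 0"
  shows "integral\<^sup>L lebesgue F = integral {a..b} F"
proof -
  have eq: "(\<lambda>x. indicat_real {a..b} x *\<^sub>R F x) = F"
    using assms(2) by (auto simp: indicator_def)
  have "set_integrable lebesgue {a..b} F"
    using assms(1) by (simp add: set_integrable_def eq)
  from set_lebesgue_integral_eq_integral(2)[OF this] show ?thesis
    by (simp add: set_lebesgue_integral_def eq)
qed

lemma integrable_continuous_scaleR: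
  fixes u :: "real \<Rightarrow> complex"
  assumes "continuous_on UNIV g" "\<And>x. x \<notin> {a..b} \<Longrightarrow> g x = 0" "locally_integrable u"
  shows "integrable lebesgue (\<lambda>x. g x *\<^sub>R u x)"
proof -
  have g: "continuous_on {a..b} g" using assms(1) continuous_on_subset by blast
  have "(\<lambda>x. g x *\<^sub>R u x) absolutely_integrable_on {a..b}"
  proof (rule absolutely_integrable_bounded_measurable_product[where h = scaleR])
    show "bilinear (scaleR :: real \<Rightarrow> complex \<Rightarrow> complex)"
      by (simp add: bilinear_conv_bounded_bilinear bounded_bilinear_scaleR)
    show "g \<in> borel_measurable (lebesgue_on {a..b})"
      using g by (rule continuous_imp_measurable_on_sets_lebesgue) simp
    show "bounded (g ` {a..b})"
      using compact_continuous_image[OF g] compact_imp_bounded by blast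
  qed (use assms(3) in \<open>auto simp: locally_integrable_def\<close>)
  moreover have "(\<lambda>x. indicat_real {a..b} x *\<^sub>R g x *\<^sub>R u x) = (\<lambda>x. g x *\<^sub>R u x)"
    using assms(2) by (force simp: indicator_def)
  ultimately show ?thesis by (simp add: set_integrable_def)
qed

lemma locally_integrable_continuous:
  "continuous_on UNIV u \<Longrightarrow> locally_integrable u"
  unfolding locally_integrable_def
  by (meson absolutely_integrable_continuous_real continuous_on_subset subset_UNIV)

section \<open>Mollification and increments of weakly differentiable functions\<close>

lemma mollifier_tendsto:
  fixes q :: "real \<Rightarrow> complex" and g :: "real \<Rightarrow> real"
  assumes g: "continuous_on {0..1} g" and q: "continuous_on {0..1} q"
  shows "(\<lambda>n. integral {0..1} (\<lambda>y. g y *\<^sub>R q (y / real (Suc n)))) \<longlonglongrightarrow> integral {0..1} g *\<^sub>R q 0"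
proof -
  obtain C where C: "\<And>y. y \<in> {0..1} \<Longrightarrow> norm (g y) \<le> C"
    using compact_imp_bounded[OF compact_continuous_image[OF g]] unfolding bounded_iff by blast
  obtain D where D: "\<And>y. y \<in> {0..1} \<Longrightarrow> norm (q y) \<le> D"
    using compact_imp_bounded[OF compact_continuous_image[OF q]] unfolding bounded_iff by blast
  \<comment> \<open>All rescaled arguments stay in the unit interval, so the bounds on
    \<open>g\<close> and \<open>q\<close> give a constant majorant; one-sided continuity of
    \<open>q\<close> at zero gives the pointwise limit.\<close>
  have in01: "y / real (Suc n) \<in> {0..1}" if "y \<in> {0..1}" for y n
    using that by (auto simp: divide_le_eq)
  have "(\<lambda>n. integral {0..1} (\<lambda>y. g y *\<^sub>R q (y / real (Suc n)))) \<longlonglongrightarrow> integral {0..1} (\<lambda>y. g y *\<^sub>R q 0)"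
  proof (rule dominated_convergence[where h = "\<lambda>_. C * D"])
    fix n
    have "continuous_on {0..1} (\<lambda>y. q (y / real (Suc n)))"
      by (rule continuous_on_compose2[OF q]) (use in01 in \<open>auto intro!: continuous_intros\<close>)
    thus "(\<lambda>y. g y *\<^sub>R q (y / real (Suc n))) integrable_on {0..1}"
      by (intro integrable_continuous_interval continuous_intros g)
    fix y :: real assume y: "y \<in> {0..1}"
    show "norm (g y *\<^sub>R q (y / real (Suc n))) \<le> C * D"
      unfolding norm_scaleR using C[OF y] D[OF in01[OF y], of n]
      by (intro mult_mono) (auto intro: order_trans[OF abs_ge_zero])
  next
    fix y :: real assume y: "y \<in> {0..1}"
    have "(\<lambda>n. y / real (Suc n)) \<longlonglongrightarrow> 0"
      using LIMSEQ_Suc[OF lim_const_over_n[of y]] by simp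
    hence "(\<lambda>n. q (y / real (Suc n))) \<longlonglongrightarrow> q 0"
      using q in01[OF y] by (auto simp: continuous_on_sequentially o_def)
    thus "(\<lambda>n. g y *\<^sub>R q (y / real (Suc n))) \<longlonglongrightarrow> g y *\<^sub>R q 0"
      by (intro tendsto_intros)
  qed auto
  also have "integral {0..1} (\<lambda>y. g y *\<^sub>R q 0) = integral {0..1} g *\<^sub>R q 0"
    using integrable_continuous_interval[OF g]
    by (intro integral_unique has_integral_scaleR_left) (rule integrable_integral)
  finally show ?thesis .
qed

lemma lebesgue_integral_rescale:
  fixes u :: "real \<Rightarrow> complex"
  assumes g: "continuous_on UNIV g" "\<And>x. x \<notin> {0..1} \<Longrightarrow> g x = 0" and u: "continuous_on UNIV u" and "N > 0"
  shows "(LINT x|lebesgue. g (N * (x - a)) *\<^sub>R u x) = integral {0..1} (\<lambda>y. g y *\<^sub>R u (a + y / N)) /\<^sub>R N"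
proof -
  have "(LINT x|lebesgue. g (N * (x - a)) *\<^sub>R u x)
          = \<bar>1 / N\<bar> *\<^sub>R (LINT y|lebesgue. g (N * ((a + 1 / N * y) - a)) *\<^sub>R u (a + 1 / N * y))"
    by (rule lebesgue_integral_real_affine) (use \<open>N > 0\<close> in simp)
  also have "\<dots> = (LINT y|lebesgue. g y *\<^sub>R u (a + y / N)) /\<^sub>R N"
  proof -
    have "N * ((a + 1 / N * y) - a) = y" "a + 1 / N * y = a + y / N" "\<bar>1 / N\<bar> = inverse N" for y
      using \<open>N > 0\<close> by (auto simp: divide_inverse)
    thus ?thesis by (simp only:)
  qed
  also have "continuous_on UNIV (\<lambda>y. u (a + y / N))"
    by (rule continuous_on_compose2[OF u]) (use \<open>N > 0\<close> in \<open>auto intro!: continuous_intros\<close>)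
  hence "(LINT y|lebesgue. g y *\<^sub>R u (a + y / N)) = integral {0..1} (\<lambda>y. g y *\<^sub>R u (a + y / N))"
    using g by (intro lebesgue_integral_eq_integral_support
                 integrable_continuous_scaleR[where a = 0 and b = 1] locally_integrable_continuous) auto
  finally show ?thesis .
qed

text \<open>Averages against kernels of mass one supported in [a, a + 1/(n+1)]. They do not see null
  sets, and each kernel is the derivative of a rescaled step, so it arises when a smoothed indicator
  function serves as test function.\<close>

definition right_average :: "(real \<Rightarrow> complex) \<Rightarrow> real \<Rightarrow> nat \<Rightarrow> complex" where
  "right_average u a n =
     (LINT x|lebesgue. (real (Suc n) * deriv smooth_step (real (Suc n) * (x - a))) *\<^sub>R u x)"

lemma smooth_deriv_smooth_step: "smooth (deriv smooth_step)"
  by (intro smooth_deriv smooth_smooth_step)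

lemma DERIV_rescale:
  assumes "smooth f"
  shows "((\<lambda>x. f (N * (x - a))) has_real_derivative N * deriv f (N * (x - a))) (at x)"
  using DERIV_affine[OF assms, of N "- N * a" x] by (simp add: algebra_simps)

lemma smooth_rescale: "smooth f \<Longrightarrow> smooth (\<lambda>x. f (N * (x - a)))"
  using smooth_affine[of f N "- N * a"] by (simp add: algebra_simps)

lemma rescale_notin:
  assumes "(x :: real) \<notin> {a..a + 1}"
  shows "real (Suc n) * (x - a) \<notin> {0..1}"
proof
  assume "real (Suc n) * (x - a) \<in> {0..1}"
  hence *: "0 \<le> real (Suc n) * (x - a)" "real (Suc n) * (x - a) \<le> 1" by auto
  have "x \<ge> a" using *(1) by (simp add: zero_le_mult_iff)
  moreover have "1 * (x - a) \<le> real (Suc n) * (x - a)" using \<open>x \<ge> a\<close> by (intro mult_right_mono) auto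
  ultimately show False using assms *(2) by auto
qed

lemma deriv_smooth_step_rescale_eq_0:
  "x \<notin> {a..a + 1} \<Longrightarrow> deriv smooth_step (real (Suc n) * (x - a)) = 0"
  by (rule deriv_smooth_step_eq_0) (use rescale_notin[of x a n] in auto)

lemma smooth_step_rescale_tendsto:
  "(\<lambda>n. smooth_step (real (Suc n) * (x - a))) \<longlonglongrightarrow> indicator {a<..} x"
proof (cases "x > a")
  case True
  obtain M where M: "real M \<ge> 1 / (x - a)" using real_arch_simple by blast
  have "smooth_step (real (Suc n) * (x - a)) = 1" if "n \<ge> M" for n
  proof -
    have "1 / (x - a) \<le> real (Suc n)" using M that by linarith
    thus ?thesis using True by (intro smooth_step_eq_1) (simp add: pos_divide_le_eq)
  qed
  thus ?thesis using True by (auto intro!: tendsto_eventually eventually_sequentiallyI)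
next
  case False
  hence "smooth_step (real (Suc n) * (x - a)) = 0" for n
    by (intro smooth_step_eq_0) (simp add: mult_le_0_iff)
  thus ?thesis using False by simp
qed

text \<open>The test functions are smooth approximations of the indicator function of \<open>{a<..b}\<close>. The limits
  \<open>La\<close> and \<open>Lb\<close> play the role of the values of \<open>u\<close>, which is only determined up to null sets.\<close>

lemma weak_derivative_increment:
  assumes uv: "has_weak_derivative u v" and "a < b"
    and La: "right_average u a \<longlonglongrightarrow> La" and Lb: "right_average u b \<longlonglongrightarrow> Lb"
  shows "Lb - La = integral {a..b} v"
proof -
  have u: "locally_integrable u" and v: "locally_integrable v"
    using uv by (auto simp: has_weak_derivative_def)
  define \<eta> where "\<eta> n x = smooth_step (real (Suc n) * (x - a)) - smooth_step (real (Suc n) * (x - b))" for n x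
  have \<eta>0: "\<eta> n x = 0" if "x \<notin> {a..b + 1}" for n x
  proof (cases "x < a")
    case True
    thus ?thesis using \<open>a < b\<close> by (simp add: \<eta>_def smooth_step_eq_0 mult_le_0_iff)
  next
    case False
    hence x: "x > b + 1" using that by auto
    hence "1 * 1 \<le> real (Suc n) * (x - a)" "1 * 1 \<le> real (Suc n) * (x - b)"
      using \<open>a < b\<close> by (intro mult_mono; simp)+
    thus ?thesis by (simp add: \<eta>_def smooth_step_eq_1)
  qed
  have sm: "smooth (\<eta> n)" for n
    unfolding \<eta>_def by (intro smooth_diff smooth_rescale smooth_smooth_step)
  have int: "integrable lebesgue (\<lambda>x. (real (Suc n) * deriv smooth_step (real (Suc n) * (x - c))) *\<^sub>R u x)" for n c
  proof (rule integrable_continuous_scaleR[OF _ _ u])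
    show "continuous_on UNIV (\<lambda>x. real (Suc n) * deriv smooth_step (real (Suc n) * (x - c)))"
      by (intro continuous_intros smooth_continuous smooth_rescale smooth_deriv_smooth_step)
    show "real (Suc n) * deriv smooth_step (real (Suc n) * (x - c)) = 0" if "x \<notin> {c..c + 1}" for x
      using deriv_smooth_step_rescale_eq_0[OF that] by simp
  qed
  have eq: "right_average u b n - right_average u a n = (LINT x|lebesgue. \<eta> n x *\<^sub>R v x)" for n
  proof -
    have "test_function (\<eta> n)" using test_function_if_smooth[OF sm \<eta>0] .
    hence weak: "(LINT x|lebesgue. deriv (\<eta> n) x *\<^sub>R u x) = - (LINT x|lebesgue. \<eta> n x *\<^sub>R v x)"
      using uv by (auto simp: has_weak_derivative_def)
    \<comment> \<open>The derivative of the test function is the difference of the kernels of the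
      two averages, so the weak identity turns the increment of averages into an integral of
      \<open>v\<close>.\<close>
    have der: "deriv (\<eta> n) x = real (Suc n) * deriv smooth_step (real (Suc n) * (x - a))
        - real (Suc n) * deriv smooth_step (real (Suc n) * (x - b))" for x
      unfolding \<eta>_def
      by (intro DERIV_imp_deriv DERIV_diff DERIV_rescale smooth_smooth_step)
    have "right_average u a n - right_average u b n = (LINT x|lebesgue. deriv (\<eta> n) x *\<^sub>R u x)"
      unfolding right_average_def Bochner_Integration.integral_diff[OF int[of n a] int[of n b], symmetric]
      by (simp only: der scaleR_diff_left)
    hence "right_average u a n - right_average u b n = - (LINT x|lebesgue. \<eta> n x *\<^sub>R v x)"
      by (simp only: weak)
    thus ?thesis by (metis minus_diff_eq minus_minus)
  qed
  have "(\<lambda>n. LINT x|lebesgue. \<eta> n x *\<^sub>R v x) \<longlonglongrightarrow> (LINT x|lebesgue. indicat_real {a<..b} x *\<^sub>R v x)"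
  proof (rule integral_dominated_convergence)
    have v': "set_integrable lebesgue {a..b + 1} v" using v by (auto simp: locally_integrable_def)
    thus "integrable lebesgue (\<lambda>x. norm (indicat_real {a..b + 1} x *\<^sub>R v x))"
      unfolding set_integrable_def by (rule integrable_norm)
    have "set_integrable lebesgue {a<..b} v"
      by (rule set_integrable_subset[OF v']) auto
    thus "(\<lambda>x. indicat_real {a<..b} x *\<^sub>R v x) \<in> borel_measurable lebesgue"
      by (auto simp: set_integrable_def dest: borel_measurable_integrable)
    show "(\<lambda>x. \<eta> n x *\<^sub>R v x) \<in> borel_measurable lebesgue" for n
      using integrable_continuous_scaleR[OF smooth_continuous[OF sm] \<eta>0 v]
      by (rule borel_measurable_integrable)
    show "AE x in lebesgue. (\<lambda>n. \<eta> n x *\<^sub>R v x) \<longlonglongrightarrow> indicat_real {a<..b} x *\<^sub>R v x"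
    proof (intro AE_I2 tendsto_intros)
      fix x
      have "\<eta> i x = smooth_step (real (Suc i) * (x - a)) - smooth_step (real (Suc i) * (x - b))" for i
        by (simp add: \<eta>_def)
      moreover have "indicat_real {a<..b} x = indicat_real {a<..} x - indicat_real {b<..} x"
        using \<open>a < b\<close> by (auto simp: indicator_def)
      ultimately show "(\<lambda>i. \<eta> i x) \<longlonglongrightarrow> indicat_real {a<..b} x"
        using tendsto_diff[OF smooth_step_rescale_tendsto[of x a] smooth_step_rescale_tendsto[of x b]] by simp
    qed
    \<comment> \<open>A difference of two numbers in the unit interval has modulus at most one, and
      the support lies in \<open>{a..b + 1}\<close> for every \<open>n\<close>.\<close>
    show "AE x in lebesgue. norm (\<eta> n x *\<^sub>R v x) \<le> norm (indicat_real {a..b + 1} x *\<^sub>R v x)" for n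
    proof (rule AE_I2)
      fix x
      have "\<bar>\<eta> n x\<bar> \<le> 1"
        using smooth_step_bounds[of "real (Suc n) * (x - a)"] smooth_step_bounds[of "real (Suc n) * (x - b)"]
        unfolding \<eta>_def by linarith
      thus "norm (\<eta> n x *\<^sub>R v x) \<le> norm (indicat_real {a..b + 1} x *\<^sub>R v x)"
        using \<eta>0[of x n] by (cases "x \<in> {a..b + 1}") (auto intro: mult_left_le_one_le)
    qed
  qed
  hence "Lb - La = (LINT x|lebesgue. indicat_real {a<..b} x *\<^sub>R v x)"
    using tendsto_diff[OF Lb La] LIMSEQ_unique unfolding eq by blast
  also have "\<dots> = (LINT x|lebesgue. indicat_real {a..b} x *\<^sub>R v x)"
  proof (rule integral_cong_AE)
    have "set_integrable lebesgue {a..b} v" using v by (auto simp: locally_integrable_def)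
    moreover from this have "set_integrable lebesgue {a<..b} v"
      by (rule set_integrable_subset) auto
    ultimately show "(\<lambda>x. indicat_real {a<..b} x *\<^sub>R v x) \<in> borel_measurable lebesgue"
      "(\<lambda>x. indicat_real {a..b} x *\<^sub>R v x) \<in> borel_measurable lebesgue"
      by (auto simp: set_integrable_def dest: borel_measurable_integrable)
    have "{a} \<in> null_sets lebesgue" using negligible_iff_null_sets negligible_sing by blast
    hence "AE x in lebesgue. x \<notin> {a}" by (rule AE_not_in)
    thus "AE x in lebesgue. indicat_real {a<..b} x *\<^sub>R v x = indicat_real {a..b} x *\<^sub>R v x"
      by (auto elim!: eventually_mono simp: indicator_def)
  qed
  also have "\<dots> = integral {a..b} v"
    using v set_lebesgue_integral_eq_integral(2)[of "{a..b}" v]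
    by (auto simp: locally_integrable_def set_lebesgue_integral_def)
  finally show ?thesis .
qed

lemma integral_deriv_smooth_step: "integral {0..1} (deriv smooth_step) = 1"
proof -
  have "(deriv smooth_step has_integral smooth_step 1 - smooth_step 0) {0..1}"
    using smooth_has_real_derivative[OF smooth_smooth_step]
    by (intro fundamental_theorem_of_calculus)
       (auto simp: has_real_derivative_iff_has_vector_derivative[symmetric] intro: has_field_derivative_at_within)
  thus ?thesis by (simp add: integral_unique smooth_step_eq_0 smooth_step_eq_1)
qed

lemma right_average_tendsto_continuous:
  assumes "continuous_on UNIV u"
  shows "right_average u a \<longlonglongrightarrow> u a"
proof -
  have "right_average u a n = integral {0..1} (\<lambda>y. deriv smooth_step y *\<^sub>R u (a + y / real (Suc n)))" for n
  proof -
    have "right_average u a n =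
        (LINT x|lebesgue. real (Suc n) *\<^sub>R deriv smooth_step (real (Suc n) * (x - a)) *\<^sub>R u x)"
      by (simp add: right_average_def)
    also have "\<dots> = real (Suc n) *\<^sub>R (LINT x|lebesgue. deriv smooth_step (real (Suc n) * (x - a)) *\<^sub>R u x)"
      by (rule integral_scaleR_right)
    also have "(LINT x|lebesgue. deriv smooth_step (real (Suc n) * (x - a)) *\<^sub>R u x) =
      integral {0..1} (\<lambda>y. deriv smooth_step y *\<^sub>R u (a + y / real (Suc n))) /\<^sub>R real (Suc n)"
      by (rule lebesgue_integral_rescale)
         (use assms in \<open>auto intro!: smooth_continuous smooth_deriv_smooth_step deriv_smooth_step_eq_0\<close>)
    finally show ?thesis by simp
  qed
  hence "right_average u a = (\<lambda>n. integral {0..1} (\<lambda>y. deriv smooth_step y *\<^sub>R u (a + y / real (Suc n))))"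
    by (rule ext)
  moreover have "(\<lambda>n. integral {0..1} (\<lambda>y. deriv smooth_step y *\<^sub>R u (a + y / real (Suc n))))
      \<longlonglongrightarrow> integral {0..1} (deriv smooth_step) *\<^sub>R u (a + 0)"
  proof (rule mollifier_tendsto[where q = "\<lambda>h. u (a + h)"])
    show "continuous_on {0..1} (\<lambda>h. u (a + h))"
      by (rule continuous_on_compose2[OF assms]) (auto intro!: continuous_intros)
  qed (rule smooth_continuous[OF smooth_deriv_smooth_step])
  ultimately show ?thesis by (simp add: integral_deriv_smooth_step)
qed

lemma weak_derivative_imp_integral:
  assumes "has_weak_derivative u v" "continuous_on UNIV u" "a \<le> b"
  shows "u b - u a = integral {a..b} v"
  using weak_derivative_increment[OF assms(1) _ right_average_tendsto_continuous right_average_tendsto_continuous]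
    assms by (cases "a = b") auto

text \<open>Used as a kernel, the second derivative S'' of the step kills constants, by its zeroth
  moment, and extracts a slope up to sign, by its first. The latter uses the antiderivative y S'(y)
  - S(y) of y S''(y).\<close>

lemma integrals_second_deriv_smooth_step:
  "integral {0..1} (deriv (deriv smooth_step)) = 0"
  "integral {0..1} (\<lambda>y. y * deriv (deriv smooth_step) y) = - 1"
proof -
  have D: "(smooth_step has_real_derivative deriv smooth_step x) (at x)"
    "(deriv smooth_step has_real_derivative deriv (deriv smooth_step) x) (at x)" for x
    by (intro smooth_has_real_derivative smooth_smooth_step smooth_deriv_smooth_step)+
  have "(deriv (deriv smooth_step) has_integral deriv smooth_step 1 - deriv smooth_step 0) {0..1}"
    using D(2) by (intro fundamental_theorem_of_calculus)
       (auto simp: has_real_derivative_iff_has_vector_derivative[symmetric] intro: has_field_derivative_at_within)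
  thus "integral {0..1} (deriv (deriv smooth_step)) = 0"
    by (simp add: integral_unique deriv_smooth_step_eq_0)
  have "((\<lambda>y. y * deriv smooth_step y - smooth_step y) has_real_derivative x * deriv (deriv smooth_step) x) (at x)" for x
    by (auto intro!: derivative_eq_intros D)
  hence "((\<lambda>y. y * deriv (deriv smooth_step) y) has_integral
      (1 * deriv smooth_step 1 - smooth_step 1) - (0 * deriv smooth_step 0 - smooth_step 0)) {0..1}"
    by (intro fundamental_theorem_of_calculus)
       (auto simp: has_real_derivative_iff_has_vector_derivative[symmetric] intro: has_field_derivative_at_within)
  thus "integral {0..1} (\<lambda>y. y * deriv (deriv smooth_step) y) = - 1"
    by (simp add: integral_unique deriv_smooth_step_eq_0 smooth_step_eq_0 smooth_step_eq_1)
qed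

lemma deriv2_smooth_step_eq_0:
  assumes "x \<notin> {0..1}"
  shows "deriv (deriv smooth_step) x = 0"
proof -
  have "open (- {0..1::real})" by (simp add: closed_Compl open_Compl)
  hence "\<forall>\<^sub>F y in nhds x. deriv smooth_step y = 0"
    using eventually_nhds_in_open[of "- {0..1}" x] assms
    by (auto elim!: eventually_mono intro: deriv_smooth_step_eq_0)
  hence "(deriv smooth_step has_real_derivative 0) (at x)" by (simp add: DERIV_cong_ev)
  thus ?thesis by (rule DERIV_imp_deriv)
qed

text \<open>Moving the derivative to the mollifier expresses the averages of \<open>v\<close> through difference
  quotients of \<open>u\<close>.\<close>

lemma right_average_tendsto_right_derivative:
  assumes uv: "has_weak_derivative u v" and u: "continuous_on UNIV u"
    and d: "((\<lambda>h. (u (a + h) - u a) /\<^sub>R h) \<longlongrightarrow> d) (at_right 0)"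
  shows "right_average v a \<longlonglongrightarrow> d"
proof -
  \<comment> \<open>Extended by its limit \<open>d\<close>, the difference quotient is continuous up
    to zero, so \<open>mollifier_tendsto\<close> applies to it.\<close>
  define q where "q h = (if h = 0 then d else (u (a + h) - u a) /\<^sub>R h)" for h
  have q: "continuous_on {0..1} q"
  proof -
    have "continuous (at h within {0..1}) q" if "h \<in> {0..1}" for h
    proof (cases "h = 0")
      case True
      have "(q \<longlongrightarrow> d) (at_right 0)"
        by (rule Lim_transform_eventually[OF d]) (auto simp: eventually_at_filter q_def)
      moreover have "at (0::real) within {0..1} \<le> at_right 0"
        by (auto simp: at_within_def le_principal eventually_inf_principal intro!: inf_mono) 
      ultimately have "(q \<longlongrightarrow> d) (at 0 within {0..1})" by (rule filterlim_mono[OF _ order_refl])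
      thus ?thesis using True by (simp add: continuous_within q_def)
    next
      case False
      have "isCont (\<lambda>h. (u (a + h) - u a) /\<^sub>R h) h"
      proof (intro continuous_intros)
        have "isCont u (a + h)" using u by (simp add: continuous_on_eq_continuous_at)
        thus "isCont (\<lambda>h. u (a + h)) h" by (rule isCont_o2[rotated]) (intro continuous_intros)
      qed (use False in auto)
      moreover have "\<forall>\<^sub>F y in nhds h. q y = (u (a + y) - u a) /\<^sub>R y"
        by (rule eventually_mono[OF t1_space_nhds[OF False]]) (simp add: q_def)
      ultimately have "isCont q h" by (simp add: isCont_cong)
      thus ?thesis by (rule continuous_at_imp_continuous_at_within)
    qed
    thus ?thesis by (simp add: continuous_on_eq_continuous_within)
  qed
  let ?S2 = "deriv (deriv smooth_step)"
  have S2: "continuous_on A ?S2" for A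
    by (intro smooth_continuous smooth_deriv smooth_smooth_step)
  have "right_average v a n = - integral {0..1} (\<lambda>y. (y * ?S2 y) *\<^sub>R q (y / real (Suc n)))" for n
  proof -
    define N where "N = real (Suc n)"
    define \<eta> where "\<eta> x = N * deriv smooth_step (N * (x - a))" for x
    have N: "N > 0" by (simp add: N_def)
    have "smooth \<eta>"
      unfolding \<eta>_def by (intro smooth_mult smooth_const smooth_rescale smooth_deriv_smooth_step)
    moreover have "\<eta> x = 0" if "x \<notin> {a..a + 1}" for x
      using deriv_smooth_step_rescale_eq_0[OF that] by (simp add: \<eta>_def N_def)
    ultimately have "test_function \<eta>" by (rule test_function_if_smooth)
    hence "(LINT x|lebesgue. deriv \<eta> x *\<^sub>R u x) = - (LINT x|lebesgue. \<eta> x *\<^sub>R v x)"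
      using uv by (auto simp: has_weak_derivative_def)
    moreover have "right_average v a n = (LINT x|lebesgue. \<eta> x *\<^sub>R v x)"
      by (simp add: right_average_def \<eta>_def N_def)
    moreover have "deriv \<eta> x = (N * N) * ?S2 (N * (x - a))" for x
      unfolding \<eta>_def using DERIV_imp_deriv[OF DERIV_cmult[OF DERIV_rescale[OF smooth_deriv_smooth_step]], of N N a x]
      by simp
    moreover have "(LINT x|lebesgue. ((N * N) * ?S2 (N * (x - a))) *\<^sub>R u x)
        = (N * N) *\<^sub>R (LINT x|lebesgue. ?S2 (N * (x - a)) *\<^sub>R u x)"
      unfolding scaleR_scaleR[symmetric, of "N * N"] by (rule integral_scaleR_right)
    moreover have "(LINT x|lebesgue. ?S2 (N * (x - a)) *\<^sub>R u x) =
       integral {0..1} (\<lambda>y. ?S2 y *\<^sub>R u (a + y / N)) /\<^sub>R N"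
      by (rule lebesgue_integral_rescale[OF S2 deriv2_smooth_step_eq_0 u N])
    moreover have "N * N * inverse N = N" using N by simp
    ultimately have "right_average v a n = - (N *\<^sub>R integral {0..1} (\<lambda>y. ?S2 y *\<^sub>R u (a + y / N)))"
      by (simp add: equation_minus_iff)
    also have "N *\<^sub>R integral {0..1} (\<lambda>y. ?S2 y *\<^sub>R u (a + y / N)) =
        integral {0..1} (\<lambda>y. (y * ?S2 y) *\<^sub>R q (y / N))"
    proof -
      \<comment> \<open>With h = y/N the factor y cancels the denominator of the quotient up to N.
        The subtracted multiple of \<open>u a\<close> contributes nothing after integration, because
        \<open>?S2\<close> has integral zero.\<close>
      have q_eq: "(y * ?S2 y) *\<^sub>R q (y / N) = N *\<^sub>R (?S2 y *\<^sub>R u (a + y / N)) - N *\<^sub>R (?S2 y *\<^sub>R u a)" for y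
        using N by (cases "y = 0") (auto simp: q_def scaleR_diff_right mult.commute)
      have i1: "(\<lambda>y. ?S2 y *\<^sub>R u (a + y / N)) integrable_on {0..1}"
        by (intro integrable_continuous_interval continuous_intros S2 continuous_on_compose2[OF u])
           (use N in auto)
      have i2: "((\<lambda>y. ?S2 y *\<^sub>R u a) has_integral 0 *\<^sub>R u a) {0..1}"
        using integrable_integral[OF integrable_continuous_interval[OF S2[of "{0..1}"]]]
          integrals_second_deriv_smooth_step(1) by (intro has_integral_scaleR_left) simp
      have "((\<lambda>y. N *\<^sub>R (?S2 y *\<^sub>R u (a + y / N)) - N *\<^sub>R (?S2 y *\<^sub>R u a)) has_integral
          N *\<^sub>R integral {0..1} (\<lambda>y. ?S2 y *\<^sub>R u (a + y / N)) - N *\<^sub>R (0 *\<^sub>R u a)) {0..1}"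
        by (intro has_integral_diff has_integral_cmul integrable_integral i1 i2)
      from integral_unique[OF this] show ?thesis unfolding q_eq by simp
    qed
    finally show ?thesis by (simp add: N_def)
  qed
  hence "right_average v a = (\<lambda>n. - integral {0..1} (\<lambda>y. (y * ?S2 y) *\<^sub>R q (y / real (Suc n))))"
    by (rule ext)
  moreover have "(\<lambda>n. - integral {0..1} (\<lambda>y. (y * ?S2 y) *\<^sub>R q (y / real (Suc n)))) \<longlonglongrightarrow>
      - (integral {0..1} (\<lambda>y. y * ?S2 y) *\<^sub>R q 0)"
    by (intro tendsto_minus mollifier_tendsto q continuous_intros S2)
  ultimately show ?thesis by (simp add: integrals_second_deriv_smooth_step q_def)
qed

section \<open>Lebesgue points and antiderivatives\<close>

lemma locally_integrable_lebesgue_points: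
  assumes "locally_integrable v"
  obtains Z where "negligible Z"
    "\<And>x. x \<notin> Z \<Longrightarrow> ((\<lambda>h. integral {x..x + h} v /\<^sub>R h) \<longlongrightarrow> v x) (at_right 0)"
proof -
  have "v integrable_on cbox a b" for a b
    using assms set_lebesgue_integral_eq_integral(1) by (auto simp: locally_integrable_def)
  \<comment> \<open>Lebesgue differentiation over cubes with \<open>x\<close> as lower corner. On
    the line these are intervals to the right of \<open>x\<close>, which matches the averages to the
    right.\<close>
  then obtain Z where Z: "negligible Z" "\<And>x e. \<lbrakk>x \<notin> Z; 0 < e\<rbrakk> \<Longrightarrow> \<exists>d>0. \<forall>h. 0 < h \<and> h < d \<longrightarrow>
      norm (integral (cbox x (x + h *\<^sub>R One)) v /\<^sub>R h ^ DIM(real) - v x) < e"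
    using integrable_ccontinuous_explicit by metis
  show ?thesis
  proof (rule that[OF Z(1)])
    fix x assume "x \<notin> Z"
    hence "\<exists>d>0. \<forall>h. 0 < h \<and> h < d \<longrightarrow> norm (integral {x..x + h} v /\<^sub>R h - v x) < e" if "e > 0" for e
      using Z(2)[of x e] that by simp
    thus "((\<lambda>h. integral {x..x + h} v /\<^sub>R h) \<longlongrightarrow> v x) (at_right 0)"
      unfolding tendsto_iff eventually_at_right_field dist_norm by (simp only: add_0_left imp_conjL) blast
  qed
qed

lemma has_vector_derivative_if_integral:
  fixes f g :: "real \<Rightarrow> 'a::banach"
  assumes g: "continuous_on UNIV g" and fg: "\<And>a b. a \<le> b \<Longrightarrow> f b - f a = integral {a..b} g"
  shows "(f has_vector_derivative g x) (at x)"
proof -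
  have g': "continuous_on {x - 1..x + 1} g" using g continuous_on_subset by blast
  have "((\<lambda>y. integral {x - 1..y} g) has_vector_derivative g x) (at x within {x - 1..x + 1})"
    by (rule integral_has_vector_derivative[OF g']) simp
  hence "((\<lambda>y. f (x - 1) + integral {x - 1..y} g) has_vector_derivative 0 + g x) (at x within {x - 1..x + 1})"
    by (rule has_vector_derivative_add[OF has_vector_derivative_const])
  hence "(f has_vector_derivative 0 + g x) (at x within {x - 1..x + 1})"
  proof (rule has_vector_derivative_transform[rotated 2])
    fix y assume "y \<in> {x - 1..x + 1}"
    thus "f y = f (x - 1) + integral {x - 1..y} g" using fg[of "x - 1" y] by (simp add: algebra_simps)
  qed simp
  moreover have "at x within {x - 1..x + 1} = at x" by (rule at_within_interior) simp
  ultimately show ?thesis by simp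
qed

lemma right_derivative_if_integral:
  assumes v: "locally_integrable v" and uv: "\<And>a b. a \<le> b \<Longrightarrow> u b - u a = integral {a..b} v"
  shows "AE x in lebesgue. ((\<lambda>h. (u (x + h) - u x) /\<^sub>R h) \<longlongrightarrow> v x) (at_right 0)"
proof -
  obtain Z where Z: "negligible Z"
    "\<And>x. x \<notin> Z \<Longrightarrow> ((\<lambda>h. integral {x..x + h} v /\<^sub>R h) \<longlongrightarrow> v x) (at_right 0)"
    using locally_integrable_lebesgue_points[OF v] by blast
  have "((\<lambda>h. (u (x + h) - u x) /\<^sub>R h) \<longlongrightarrow> v x) (at_right 0)" if "x \<notin> Z" for x
    by (rule Lim_transform_eventually[OF Z(2)[OF that]]) (auto simp: eventually_at_filter uv)
  moreover have "AE x in lebesgue. x \<notin> Z"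
    using Z(1) negligible_iff_null_sets AE_not_in by blast
  ultimately show ?thesis by (auto elim!: eventually_mono)
qed

lemma antiderivative_of_locally_integrable:
  fixes v :: "real \<Rightarrow> complex"
  assumes "locally_integrable v"
  obtains F where "continuous_on UNIV F" "\<And>a b. a \<le> b \<Longrightarrow> F b - F a = integral {a..b} v"
proof -
  have v: "v integrable_on {a..b}" for a b
    using assms set_lebesgue_integral_eq_integral(1) by (auto simp: locally_integrable_def)
  define F where "F x = (if x \<ge> 0 then integral {0..x} v else - integral {x..0} v)" for x
  have F: "F b - F a = integral {a..b} v" if "a \<le> b" for a b
  proof -
    consider "0 \<le> a" | "a < 0" "0 \<le> b" | "b < 0" using that by linarith
    thus ?thesis
    proof cases
      case 1
      thus ?thesis using that Henstock_Kurzweil_Integration.integral_combine[OF 1 that v] by (simp add: F_def algebra_simps)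
    next
      case 2
      thus ?thesis using Henstock_Kurzweil_Integration.integral_combine[of a 0 b, OF _ _ v] by (simp add: F_def algebra_simps)
    next
      case 3
      thus ?thesis using that Henstock_Kurzweil_Integration.integral_combine[of a b 0, OF that _ v] by (simp add: F_def algebra_simps)
    qed
  qed
  have "isCont F x" for x
  proof -
    have "continuous_on {x - 1..x + 1} (\<lambda>y. F (x - 1) + integral {x - 1..y} v)"
      by (intro continuous_intros indefinite_integral_continuous_1 v)
    hence "continuous_on {x - 1..x + 1} F"
    proof (rule continuous_on_eq)
      fix y assume "y \<in> {x - 1..x + 1}"
      hence "F y - F (x - 1) = integral {x - 1..y} v" by (intro F) simp
      thus "F (x - 1) + integral {x - 1..y} v = F y" by (simp only: diff_eq_eq) simp
    qed
    thus ?thesis by (rule continuous_on_interior) simp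
  qed
  thus ?thesis using that[of F] F by (simp add: continuous_on_eq_continuous_at)
qed

section \<open>Regularity of stationary solutions\<close>

lemma integral_cong_AE_lebesgue:
  assumes "AE x in lebesgue. f x = g x"
  shows "integral S f = integral S g"
proof -
  obtain Z where Z: "Z \<in> null_sets lebesgue" "\<And>x. f x \<noteq> g x \<Longrightarrow> x \<in> Z"
    using assms unfolding eventually_ae_filter by auto
  show ?thesis
  proof (rule integral_spike)
    show "negligible Z" using Z(1) negligible_iff_null_sets by blast
    show "g x = f x" if "x \<in> S - Z" for x using Z(2)[of x] that by (metis DiffD2)
  qed
qed

lemma AE_lebesgue_ex:
  assumes "AE x in lebesgue. P (x :: real)"
  obtains x where "P x"
proof -
  have "\<exists>x. P x"
  proof (rule ccontr)
    assume "\<nexists>x. P x"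
    hence "AE x in (lebesgue :: real measure). False" using assms by simp
    hence "negligible (UNIV :: real set)"
      by (auto simp: eventually_ae_filter negligible_iff_null_sets top.extremum_unique)
    thus False by simp
  qed
  thus ?thesis using that by blast
qed

text \<open>At almost every point \<open>\<phi>\<close> has right derivative \<open>\<phi>x\<close>,
  and there the averages of \<open>\<phi>x\<close> converge to its value. Between such points
  \<open>\<phi>x\<close> grows by the integral of \<open>\<phi>xx\<close>, so it agrees almost
  everywhere with a continuous \<open>p\<close>; the equation then makes \<open>p\<close> itself
  differentiable. The last conclusion serves to carry square integrability over to
  \<open>p\<close>.\<close>

lemma stationary_C2:
  assumes w1: "has_weak_derivative \<phi> \<phi>x" and w2: "has_weak_derivative \<phi>x \<phi>xx" and cont: "continuous_on UNIV \<phi>"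
    and eq: "AE x in lebesgue. \<phi>xx x + \<i> * (\<phi> x)\<^sup>2 * cnj (\<phi>x x) = 0"
  obtains p where "\<And>x. (\<phi> has_vector_derivative p x) (at x)"
    "\<And>x. (p has_vector_derivative - \<i> * (\<phi> x)\<^sup>2 * cnj (p x)) (at x)"
    "\<And>v. has_weak_derivative \<phi> v \<Longrightarrow> AE x in lebesgue. v x = p x"
proof -
  have \<phi>: "\<phi> b - \<phi> a = integral {a..b} v" if "a \<le> b" "has_weak_derivative \<phi> v" for a b v
    using weak_derivative_imp_integral[OF that(2) cont that(1)] .
  have li: "locally_integrable \<phi>x" "locally_integrable \<phi>xx"
    using w1 w2 by (auto simp: has_weak_derivative_def)
  have good: "AE x in lebesgue. ((\<lambda>h. (\<phi> (x + h) - \<phi> x) /\<^sub>R h) \<longlongrightarrow> v x) (at_right 0)"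
    if "has_weak_derivative \<phi> v" for v
    using that \<phi> by (intro right_derivative_if_integral) (auto simp: has_weak_derivative_def)
  have avg: "right_average \<phi>x x \<longlonglongrightarrow> \<phi>x x"
    if "((\<lambda>h. (\<phi> (x + h) - \<phi> x) /\<^sub>R h) \<longlongrightarrow> \<phi>x x) (at_right 0)" for x
    using right_average_tendsto_right_derivative[OF w1 cont that] .
  obtain F where F: "continuous_on UNIV F" "\<And>a b. a \<le> b \<Longrightarrow> F b - F a = integral {a..b} \<phi>xx"
    using antiderivative_of_locally_integrable[OF li(2)] by blast
  \<comment> \<open>A point where the value of \<open>\<phi>x\<close> is meaningful fixes the
    constant of integration in \<open>p\<close>.\<close>
  obtain x0 where x0: "((\<lambda>h. (\<phi> (x0 + h) - \<phi> x0) /\<^sub>R h) \<longlongrightarrow> \<phi>x x0) (at_right 0)"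
    by (rule AE_lebesgue_ex[OF good[OF w1]])
  define p where "p x = \<phi>x x0 + (F x - F x0)" for x
  have "\<phi>x x = p x" if "((\<lambda>h. (\<phi> (x + h) - \<phi> x) /\<^sub>R h) \<longlongrightarrow> \<phi>x x) (at_right 0)" for x
  proof -
    consider "x < x0" | "x = x0" | "x > x0" by linarith
    thus ?thesis
    proof cases
      case 1
      thus ?thesis using weak_derivative_increment[OF w2 1 avg[OF that] avg[OF x0]] F(2)[of x x0]
        by (simp add: p_def algebra_simps)
    next
      case 3
      thus ?thesis using weak_derivative_increment[OF w2 3 avg[OF x0] avg[OF that]] F(2)[of x0 x]
        by (simp add: p_def algebra_simps)
    qed (simp add: p_def)
  qed
  hence ae_p: "AE x in lebesgue. \<phi>x x = p x" using good[OF w1] by (auto elim!: eventually_mono)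
  have cp: "continuous_on UNIV p" unfolding p_def by (intro continuous_intros F)
  have dphi: "(\<phi> has_vector_derivative p x) (at x)" for x
    using \<phi>[OF _ w1] integral_cong_AE_lebesgue[OF ae_p]
    by (intro has_vector_derivative_if_integral[OF cp]) auto
  \<comment> \<open>Almost everywhere \<open>\<phi>xx\<close> equals a continuous function, so the
    fundamental theorem gives the derivative of \<open>p\<close> at every point.\<close>
  have "AE x in lebesgue. \<phi>xx x = - \<i> * (\<phi> x)\<^sup>2 * cnj (p x)"
    using eq ae_p by eventually_elim (simp add: eq_neg_iff_add_eq_0)
  from integral_cong_AE_lebesgue[OF this]
  have dp: "(p has_vector_derivative - \<i> * (\<phi> x)\<^sup>2 * cnj (p x)) (at x)" for x
    by (intro has_vector_derivative_if_integral[where g = "\<lambda>x. - \<i> * (\<phi> x)\<^sup>2 * cnj (p x)"]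
          continuous_intros cont cp) (use F(2) in \<open>auto simp: p_def\<close>)
  \<comment> \<open>The right derivative of \<open>\<phi>\<close> is \<open>v x\<close> at almost
    every point and \<open>p x\<close> at every point.\<close>
  have "AE x in lebesgue. v x = p x" if "has_weak_derivative \<phi> v" for v
    using good[OF that]
  proof eventually_elim
    case (elim x)
    have "((\<lambda>h. (\<phi> (x + h) - \<phi> x) /\<^sub>R h) \<longlongrightarrow> p x) (at 0)"
      using dphi[of x]
      by (simp add: has_vector_derivative_complex_iff DERIV_def tendsto_complex_iff divide_inverse mult.commute)
    hence "((\<lambda>h. (\<phi> (x + h) - \<phi> x) /\<^sub>R h) \<longlongrightarrow> p x) (at_right 0)"
      by (rule filterlim_mono[OF _ order_refl at_le]) simp
    thus ?case using elim tendsto_unique trivial_limit_at_right_real by blast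
  qed
  thus ?thesis using that dphi dp by blast
qed

text \<open>The set where an essential bound fails is open and null, hence empty.\<close>

lemma continuous_Linf_bounded:
  assumes "continuous_on UNIV u" "u \<in> Linf_space"
  obtains C where "\<And>x. norm (u x) \<le> C"
proof -
  obtain C where C: "AE x in lebesgue. norm (u x) \<le> C" using assms(2) by (auto simp: Linf_space_def)
  have op: "open {x. C < norm (u x)}"
    using assms(1) by (intro open_Collect_less continuous_intros)
  have "{x. C < norm (u x)} \<in> null_sets lebesgue"
    using C op by (subst AE_iff_null_sets) (auto simp: not_less)
  hence "{x. C < norm (u x)} = {}" using op open_not_negligible negligible_iff_null_sets by blast
  thus ?thesis using that[of C] by (auto simp: not_less[symmetric])
qed

text \<open>Otherwise \<open>f\<close> would dominate \<open>e\<close> times the indicator of a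
  half-line, which has infinite measure.\<close>

lemma integrable_ex_small:
  fixes f :: "real \<Rightarrow> real"
  assumes f: "integrable lebesgue f" and "e > 0"
  shows "\<exists>x\<ge>N. f x < e"
proof (rule ccontr)
  assume "\<not> ?thesis"
  hence ge: "f x \<ge> e" if "x \<ge> N" for x using that by (auto simp: not_less)
  have "integrable lebesgue (\<lambda>x. indicator {N..} x *\<^sub>R e)"
  proof (rule Bochner_Integration.integrable_bound[OF f])
    show "AE x in lebesgue. norm (indicator {N..} x *\<^sub>R e) \<le> norm (f x)"
      using ge \<open>e > 0\<close> by (auto simp: indicator_def intro!: AE_I2 order_trans[OF ge])
    show "(\<lambda>x. indicator {N..} x *\<^sub>R e) \<in> borel_measurable lebesgue"
      by (intro borel_measurable_scaleR borel_measurable_indicator borel_measurable_const) simp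
  qed
  hence "emeasure lebesgue {N..} < \<infinity>"
    using \<open>e > 0\<close> by (simp add: integrable_indicator_iff)
  moreover have "emeasure lebesgue {N..} = \<infinity>"
  proof -
    have "of_nat n \<le> emeasure lebesgue {N..}" for n :: nat
    proof -
      have "emeasure lebesgue {N..N + real n} \<le> emeasure lebesgue {N..}"
        by (intro emeasure_mono) auto
      thus ?thesis by (simp add: ennreal_of_nat_eq_real_of_nat)
    qed
    thus ?thesis by (metis ennreal_Ex_less_of_nat infinity_ennreal_def less_top not_less)
  qed
  ultimately show False by simp
qed

subsection \<open>The ordinary differential equations\<close>

text \<open>Gronwall's argument: w^2 exp(-2 C x) is nonincreasing and w^2 exp(2 C x) is
  nondecreasing, so a zero propagates to both sides. It is applied in contrapositive form, to show
  that \<open>w\<close> has no zeros at all.\<close>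

lemma zero_if_derivative_bounded:
  fixes w w' :: "real \<Rightarrow> real"
  assumes w: "\<And>x. (w has_real_derivative w' x) (at x)" and C: "\<And>x. \<bar>w' x\<bar> \<le> C * \<bar>w x\<bar>" and "w x1 = 0"
  shows "w x = 0"
proof -
  have bd: "\<bar>2 * w x * w' x\<bar> \<le> 2 * C * (w x)\<^sup>2" for x
  proof -
    have "\<bar>w x\<bar> * \<bar>w' x\<bar> \<le> \<bar>w x\<bar> * (C * \<bar>w x\<bar>)" using C by (intro mult_left_mono) auto
    thus ?thesis by (simp add: abs_mult power2_eq_square mult_ac)
  qed
  have deriv: "((\<lambda>x. (w x)\<^sup>2 * exp (r * x)) has_real_derivative (2 * w x * w' x + r * (w x)\<^sup>2) * exp (r * x)) (at x)" for r x
    by (auto intro!: derivative_eq_intros w simp: algebra_simps)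
  show ?thesis
  proof (cases "x \<ge> x1")
    case True
    have "(w x)\<^sup>2 * exp ((- (2 * C)) * x) \<le> (w x1)\<^sup>2 * exp ((- (2 * C)) * x1)"
    proof (rule DERIV_nonpos_imp_nonincreasing[OF True], intro exI conjI)
      fix y
      show "(2 * w y * w' y + (- (2 * C)) * (w y)\<^sup>2) * exp ((- (2 * C)) * y) \<le> 0"
        using bd[of y] by (intro mult_nonpos_nonneg) auto
    qed (rule deriv)
    thus ?thesis using \<open>w x1 = 0\<close> by (simp add: mult_le_0_iff)
  next
    case False
    hence "x \<le> x1" by simp
    have "(w x)\<^sup>2 * exp ((2 * C) * x) \<le> (w x1)\<^sup>2 * exp ((2 * C) * x1)"
    proof (rule DERIV_nonneg_imp_nondecreasing[OF \<open>x \<le> x1\<close>], intro exI conjI)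
      fix y
      show "0 \<le> (2 * w y * w' y + (2 * C) * (w y)\<^sup>2) * exp ((2 * C) * y)"
        using bd[of y] by (intro mult_nonneg_nonneg) auto
    qed (rule deriv)
    thus ?thesis using \<open>w x1 = 0\<close> by (simp add: mult_le_0_iff)
  qed
qed

text \<open>The operator factors: u' + r u and u' - r u are exponentials with amplitudes a and b.
  The energy identity gives a b = -(r A)^2, so the amplitudes have opposite signs and a shift
  balances them into a hyperbolic cosine.\<close>

lemma hyperbolic_ODE:
  fixes u u' :: "real \<Rightarrow> real"
  assumes u: "\<And>x. (u has_real_derivative u' x) (at x)" "\<And>x. (u' has_real_derivative r\<^sup>2 * u x) (at x)"
    and energy: "\<And>x. (u' x)\<^sup>2 = r\<^sup>2 * ((u x)\<^sup>2 - A\<^sup>2)" and "r > 0" "A > 0"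
  shows "\<exists>x0. (\<forall>x. u x = A * cosh (r * (x - x0))) \<or> (\<forall>x. u x = - (A * cosh (r * (x - x0))))"
proof -
  have exp_sol: "f x = f 0 * exp (c * x)" if "\<And>x. (f has_real_derivative c * f x) (at x)" for f c and x :: real
  proof -
    have "((\<lambda>x. f x * exp (- c * x)) has_real_derivative 0) (at x)" for x
      by (auto intro!: derivative_eq_intros that)
    hence "f x * exp (- c * x) = f 0 * exp (- c * 0)" using DERIV_isconst_all by blast
    hence "f x * (exp (- c * x) * exp (c * x)) = f 0 * exp (c * x)" by simp
    thus ?thesis by (simp flip: exp_add)
  qed
  define a where "a = u' 0 + r * u 0"
  define b where "b = u' 0 - r * u 0"
  have plus: "u' x + r * u x = a * exp (r * x)" for x
    unfolding a_def by (rule exp_sol) (auto intro!: derivative_eq_intros u simp: power2_eq_square algebra_simps)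
  have minus: "u' x - r * u x = b * exp (- r * x)" for x
    unfolding b_def by (rule exp_sol) (auto intro!: derivative_eq_intros u simp: power2_eq_square algebra_simps)
  have u_eq: "2 * r * u x = a * exp (r * x) - b * exp (- r * x)" for x
    unfolding plus[symmetric] minus[symmetric] by simp
  have ab: "a * b = - (r * A)\<^sup>2"
    using energy[of 0] by (simp add: a_def b_def power2_eq_square algebra_simps)
  hence "a \<noteq> 0" using \<open>r > 0\<close> \<open>A > 0\<close> by auto
  \<comment> \<open>The point where the two exponentials have the same modulus, namely r A.\<close>
  define x0 where "x0 = - ln (\<bar>a\<bar> / (r * A)) / r"
  have "exp (- (r * x0)) = \<bar>a\<bar> / (r * A)"
    using \<open>r > 0\<close> \<open>A > 0\<close> \<open>a \<noteq> 0\<close> by (simp add: x0_def)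
  hence a: "\<bar>a\<bar> = r * A * exp (- (r * x0))" using \<open>r > 0\<close> \<open>A > 0\<close> by simp
  have b: "b = - sgn a * (r * A * exp (r * x0))"
  proof -
    have "a * (- sgn a * (r * A * exp (r * x0))) = - (\<bar>a\<bar> * (r * A * exp (r * x0)))"
      by (simp add: abs_sgn)
    also have "\<dots> = - ((r * A)\<^sup>2 * (exp (- (r * x0)) * exp (r * x0)))" by (simp add: a power2_eq_square)
    also have "\<dots> = a * b" by (simp add: ab flip: exp_add)
    finally show ?thesis using \<open>a \<noteq> 0\<close> by (metis mult_left_cancel)
  qed
  have "u x = sgn a * (A * cosh (r * (x - x0)))" for x
  proof -
    have "2 * r * u x = sgn a * (r * A) * (exp (- (r * x0)) * exp (r * x) + exp (r * x0) * exp (- r * x))"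
      unfolding u_eq b using a sgn_mult_abs[of a] by (simp add: algebra_simps)
    also have "exp (- (r * x0)) * exp (r * x) + exp (r * x0) * exp (- r * x) = 2 * cosh (r * (x - x0))"
      by (simp add: cosh_def algebra_simps flip: exp_add)
    finally have "(2 * r) * u x = (2 * r) * (sgn a * (A * cosh (r * (x - x0))))" by (simp add: mult_ac)
    thus ?thesis using \<open>r > 0\<close> by simp
  qed
  thus ?thesis using \<open>a \<noteq> 0\<close> by (cases "a > 0") (auto intro!: exI[of _ x0])
qed

text \<open>The identities are multiplied out by \<open>k\<close>, so that zeros of \<open>\<phi>\<close> need no separate treatment.\<close>

lemma stationary_first_integrals:
  fixes \<phi> p :: "real \<Rightarrow> complex"
  assumes \<phi>: "\<And>x. (\<phi> has_vector_derivative p x) (at x)"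
    and p: "\<And>x. (p has_vector_derivative - \<i> * (\<phi> x)\<^sup>2 * cnj (p x)) (at x)"
  defines "k \<equiv> \<lambda>x. (cmod (\<phi> x))\<^sup>2"
  obtains K B E0 where
    "\<And>x. (k has_real_derivative K x) (at x)"
    "\<And>x. (K has_real_derivative 5 / 6 * k x ^ 3 - 6 * B * k x + 2 * E0) (at x)"
    "\<And>x. (K x)\<^sup>2 = 5 / 12 * k x ^ 4 - 6 * B * (k x)\<^sup>2 + 4 * E0 * k x - 4 * B\<^sup>2"
    "\<And>x. (cmod (p x))\<^sup>2 = k x ^ 3 / 6 - 2 * B * k x + E0"
    "\<And>x. (B - (k x)\<^sup>2 / 4)\<^sup>2 \<le> k x * (cmod (p x))\<^sup>2"
    "\<And>x. p x * of_real (k x) = \<phi> x * Complex (K x / 2) (B - (k x)\<^sup>2 / 4)"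
proof -
  define a b c d where "a x = Re (\<phi> x)" and "b x = Im (\<phi> x)" and "c x = Re (p x)" and "d x = Im (p x)" for x
  note abcd = a_def b_def c_def d_def
  have da: "(a has_real_derivative c x) (at x)" and db: "(b has_real_derivative d x) (at x)" for x
    using \<phi>[of x] by (auto simp: has_vector_derivative_complex_iff abcd[abs_def])
  have "Re (- \<i> * (\<phi> x)\<^sup>2 * cnj (p x)) = 2 * a x * b x * c x - ((a x)\<^sup>2 - (b x)\<^sup>2) * d x"
    "Im (- \<i> * (\<phi> x)\<^sup>2 * cnj (p x)) = - ((a x)\<^sup>2 - (b x)\<^sup>2) * c x - 2 * a x * b x * d x" for x
    by (simp_all add: abcd power2_eq_square algebra_simps)
  hence dc: "(c has_real_derivative 2 * a x * b x * c x - ((a x)\<^sup>2 - (b x)\<^sup>2) * d x) (at x)"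
    and dd: "(d has_real_derivative - ((a x)\<^sup>2 - (b x)\<^sup>2) * c x - 2 * a x * b x * d x) (at x)" for x
    using p[of x] unfolding has_vector_derivative_complex_iff abcd[abs_def] by metis+
  have k: "k x = (a x)\<^sup>2 + (b x)\<^sup>2" and E: "(cmod (p x))\<^sup>2 = (c x)\<^sup>2 + (d x)\<^sup>2" for x
    by (simp_all add: k_def cmod_power2 abcd)
  \<comment> \<open>Where \<open>\<phi>\<close> is nonzero with phase theta, \<open>J\<close> is k
    theta'; \<open>K\<close> is the derivative of \<open>k\<close>.\<close>
  define J where "J x = a x * d x - b x * c x" for x
  define K where "K x = 2 * (a x * c x + b x * d x)" for x
  have dk: "(k has_real_derivative K x) (at x)" for x
    unfolding k[abs_def] K_def by (auto intro!: derivative_eq_intros da db)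
  have dJ: "(J has_real_derivative - k x * K x / 2) (at x)" for x
    unfolding J_def by (auto intro!: derivative_eq_intros da db dc dd) (simp add: k K_def, algebra)
  have "((\<lambda>x. J x + (k x)\<^sup>2 / 4) has_real_derivative 0) (at x)" for x
    by (auto intro!: derivative_eq_intros dJ dk)
  hence "J x + (k x)\<^sup>2 / 4 = J 0 + (k 0)\<^sup>2 / 4" for x using DERIV_isconst_all by blast
  then obtain B where J: "J x = B - (k x)\<^sup>2 / 4" for x by (metis add_diff_cancel_right')
  define E where "E x = (c x)\<^sup>2 + (d x)\<^sup>2" for x
  have dE: "(E has_real_derivative - 2 * K x * (B - (k x)\<^sup>2 / 4)) (at x)" for x
  proof -
    have "(E has_real_derivative - 2 * K x * J x) (at x)"
      unfolding E_def by (auto intro!: derivative_eq_intros dc dd) (simp add: J_def K_def, algebra)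
    thus ?thesis by (simp add: J)
  qed
  \<comment> \<open>With \<open>J\<close> expressed through \<open>k\<close>, the derivative -2 K (B
    - k^2/4) of \<open>E\<close> is that of k^3/6 - 2 B k.\<close>
  have "((\<lambda>x. E x - (k x ^ 3 / 6 - 2 * B * k x)) has_real_derivative 0) (at x)" for x
    by (auto intro!: derivative_eq_intros dE dk) (simp add: algebra_simps power2_eq_square)
  hence "E x - (k x ^ 3 / 6 - 2 * B * k x) = E 0 - (k 0 ^ 3 / 6 - 2 * B * k 0)" for x using DERIV_isconst_all by blast
  then obtain E0 where E0: "E x = k x ^ 3 / 6 - 2 * B * k x + E0" for x by (metis add.commute diff_add_cancel)
  \<comment> \<open>Lagrange's identity for the plane vectors (a, b) and (c, d).\<close>
  have lagrange: "(K x)\<^sup>2 = 4 * (k x * E x - (J x)\<^sup>2)" for x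
    unfolding K_def k E_def J_def by algebra
  show ?thesis
  proof (rule that[of K B E0])
    show "(k has_real_derivative K x) (at x)" for x by (rule dk)
    show "(K has_real_derivative 5 / 6 * k x ^ 3 - 6 * B * k x + 2 * E0) (at x)" for x
    proof -
      \<comment> \<open>The second-order equation is taken from the system itself: differentiating
        the formula for K^2 would give it only where \<open>K\<close> is nonzero.\<close>
      have "(K has_real_derivative 2 * E x - 2 * k x * J x) (at x)"
        unfolding K_def by (auto intro!: derivative_eq_intros da db dc dd) (simp add: J_def k E_def, algebra)
      moreover have "2 * E x - 2 * k x * J x = 5 / 6 * k x ^ 3 - 6 * B * k x + 2 * E0"
        by (simp add: E0 J field_simps power2_eq_square power3_eq_cube)
      ultimately show ?thesis by simp
    qed
    show "(K x)\<^sup>2 = 5 / 12 * k x ^ 4 - 6 * B * (k x)\<^sup>2 + 4 * E0 * k x - 4 * B\<^sup>2" for x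
      unfolding lagrange E0 J by (simp add: field_simps power2_eq_square power3_eq_cube power4_eq_xxxx)
    show "(cmod (p x))\<^sup>2 = k x ^ 3 / 6 - 2 * B * k x + E0" for x
      using E0[of x] by (simp add: E E_def)
    show "(B - (k x)\<^sup>2 / 4)\<^sup>2 \<le> k x * (cmod (p x))\<^sup>2" for x
    proof -
      have "0 \<le> 4 * (k x * E x - (J x)\<^sup>2)" by (simp only: zero_le_power2 flip: lagrange)
      hence "0 \<le> k x * E x - (J x)\<^sup>2" by simp
      thus ?thesis unfolding E E_def[symmetric] J[symmetric] by simp
    qed
    show "p x * of_real (k x) = \<phi> x * Complex (K x / 2) (B - (k x)\<^sup>2 / 4)" for x
    proof -
      have "\<phi> x = Complex (a x) (b x)" "p x = Complex (c x) (d x)" by (simp_all add: abcd)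
      thus ?thesis
        unfolding J[symmetric] by (simp add: complex_eq_iff K_def J_def k power2_eq_square algebra_simps)
    qed
  qed
qed

text \<open>If \<open>k\<close> is nonzero somewhere, the Gronwall bound makes it nonzero
  everywhere. Then (1/k)'' = 0, while the energy identity forbids slope zero, so the affine function
  1/k would have a root.\<close>

lemma zero_profile:
  fixes k K :: "real \<Rightarrow> real"
  assumes k: "\<And>x. (k has_real_derivative K x) (at x)" "\<And>x. (K has_real_derivative 5 / 6 * k x ^ 3) (at x)"
    and K: "\<And>x. (K x)\<^sup>2 = 5 / 12 * k x ^ 4" and bd: "\<And>x. \<bar>k x\<bar> \<le> M"
  shows "k x = 0"
proof (rule ccontr)
  assume "k x \<noteq> 0"
  have "\<bar>K y\<bar> \<le> M * \<bar>k y\<bar>" for y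
  proof -
    \<comment> \<open>The coefficient 5/12 is below one; of the two factors in k^2, one is then
      bounded by \<open>M\<close>.\<close>
    have "(K y)\<^sup>2 \<le> ((k y)\<^sup>2)\<^sup>2" unfolding K by (simp flip: power_mult)
    hence "\<bar>K y\<bar> \<le> (k y)\<^sup>2" using abs_le_square_iff[of "K y" "(k y)\<^sup>2"] by simp
    also have "\<dots> = \<bar>k y\<bar> * \<bar>k y\<bar>" by (simp add: power2_eq_square)
    also have "\<dots> \<le> M * \<bar>k y\<bar>" using bd by (intro mult_right_mono) auto
    finally show ?thesis .
  qed
  hence k0: "k y \<noteq> 0" for y
    using zero_if_derivative_bounded[of k K M y x] k(1) \<open>k x \<noteq> 0\<close> by blast
  define z' where "z' y = - K y / (k y)\<^sup>2" for y
  have dz: "((\<lambda>y. 1 / k y) has_real_derivative z' y) (at y)" for y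
    using k0[of y] by (auto intro!: derivative_eq_intros k simp: z'_def power2_eq_square)
  have "(z' has_real_derivative 0) (at y)" for y
  proof -
    have "(z' has_real_derivative (- (5 / 6 * k y ^ 3) * (k y)\<^sup>2 + 2 * (K y)\<^sup>2 * k y) / (k y)\<^sup>2 ^ 2) (at y)"
      unfolding z'_def using k0[of y]
      by (auto intro!: derivative_eq_intros k simp: power2_eq_square) (simp add: field_simps)
    moreover have "- (5 / 6 * k y ^ 3) * (k y)\<^sup>2 + 2 * (K y)\<^sup>2 * k y = 0"
      unfolding K by (simp add: power2_eq_square power3_eq_cube power4_eq_xxxx)
    ultimately show ?thesis by (simp only: div_0)
  qed
  hence z': "z' y = z' 0" for y using DERIV_isconst_all by blast
  have "((\<lambda>y. 1 / k y - z' 0 * y) has_real_derivative 0) (at y)" for y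
    using DERIV_diff[OF dz[of y] DERIV_cmult_Id[of "z' 0"]] z'[of y] by simp
  hence z: "1 / k y - z' 0 * y = 1 / k 0 - z' 0 * 0" for y using DERIV_isconst_all by blast
  have "K 0 \<noteq> 0" using K[of 0] k0[of 0] by auto
  hence "z' 0 \<noteq> 0" using k0[of 0] by (simp add: z'_def)
  hence "1 / k (- (1 / k 0) / z' 0) = 0" using z[of "- (1 / k 0) / z' 0"] by simp
  thus False using k0 by simp
qed

text \<open>The quartic has the double root 2 s, so with w = 2 s - k it is w^2 times a quadratic.
  Hence |w'| is at most a constant times |w|, \<open>w\<close> has no zeros, and the substitution
  1/w makes the equation linear.\<close>

lemma dark_soliton_profile:
  fixes k K :: "real \<Rightarrow> real"
  assumes k: "\<And>x. (k has_real_derivative K x) (at x)"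
      "\<And>x. (K has_real_derivative 5 / 6 * k x ^ 3 - 6 * s\<^sup>2 * k x + 16 / 3 * s ^ 3) (at x)"
    and K: "\<And>x. (K x)\<^sup>2 = 5 / 12 * k x ^ 4 - 6 * s\<^sup>2 * (k x)\<^sup>2 + 32 / 3 * s ^ 3 * k x - 4 * s ^ 4"
    and "s > 0" and bd: "\<And>x. \<bar>k x\<bar> \<le> M" and "k x1 \<noteq> 2 * s"
  shows "\<exists>x0. \<forall>x. k x = k_profile (s\<^sup>2) (x - x0)"
proof -
  define w where "w x = 2 * s - k x" for x
  have dw: "(w has_real_derivative - K x) (at x)" for x
    unfolding w_def by (auto intro!: derivative_eq_intros k)
  have Kw: "(K x)\<^sup>2 = (w x)\<^sup>2 * (4 * s\<^sup>2 - 10 / 3 * s * w x + 5 / 12 * (w x)\<^sup>2)" for x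
    unfolding K w_def by (simp add: field_simps power2_eq_square power3_eq_cube power4_eq_xxxx)
  define W where "W = 2 * s + M"
  have W: "\<bar>w x\<bar> \<le> W" for x using bd[of x] \<open>s > 0\<close> unfolding w_def W_def by linarith
  hence "W \<ge> 0" by (meson abs_ge_zero order_trans)
  \<comment> \<open>A bound for the quadratic cofactor while |w| is at most
    \<open>W\<close>.\<close>
  define Q where "Q = 4 * s\<^sup>2 + 10 / 3 * s * W + 5 / 12 * W\<^sup>2"
  have "\<bar>- K x\<bar> \<le> sqrt Q * \<bar>w x\<bar>" for x
  proof -
    have "(w x)\<^sup>2 \<le> W\<^sup>2" using W[of x] by (simp add: abs_le_square_iff[symmetric])
    moreover have "- w x \<le> W" using W[of x] by linarith
    hence "s * - w x \<le> s * W" using \<open>s > 0\<close> by (intro mult_left_mono) auto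
    ultimately have "4 * s\<^sup>2 - 10 / 3 * s * w x + 5 / 12 * (w x)\<^sup>2 \<le> Q" by (simp add: Q_def)
    hence "(K x)\<^sup>2 \<le> (w x)\<^sup>2 * Q" unfolding Kw by (intro mult_left_mono) auto
    from real_sqrt_le_mono[OF this] show ?thesis by (simp add: real_sqrt_mult mult.commute)
  qed
  hence w0: "w x \<noteq> 0" for x
    using zero_if_derivative_bounded[of w "\<lambda>x. - K x" "sqrt Q" x x1] dw \<open>k x1 \<noteq> 2 * s\<close>
    by (auto simp: w_def)
  \<comment> \<open>The function 1/w solves z'' = 4 s^2 z - 5 s/3, whose constant solution is 5/(12
    s); subtracting it makes the equation homogeneous.\<close>
  define u where "u x = 1 / w x - 5 / (12 * s)" for x
  define u' where "u' x = K x / (w x)\<^sup>2" for x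
  \<comment> \<open>Completing the square in z'^2 = 4 s^2 z^2 - (10/3) s z + 5/12, where z = 1/w,
    leaves 4 s^2 (u^2 - A^2) with this \<open>A\<close>.\<close>
  define A where "A = sqrt (5 / (72 * s\<^sup>2))"
  have "A > 0" using \<open>s > 0\<close> by (simp add: A_def)
  have A2: "A\<^sup>2 = 5 / (72 * s\<^sup>2)" by (simp add: A_def)
  have du: "(u has_real_derivative u' x) (at x)" for x
    unfolding u_def u'_def using w0[of x] by (auto intro!: derivative_eq_intros dw simp: power2_eq_square)
  have du': "(u' has_real_derivative (2 * s)\<^sup>2 * u x) (at x)" for x
  proof -
    have dK: "(K has_real_derivative - 4 * s\<^sup>2 * w x + 5 * s * (w x)\<^sup>2 - 5 / 6 * w x ^ 3) (at x)"
    proof -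
      have "5 / 6 * k x ^ 3 - 6 * s\<^sup>2 * k x + 16 / 3 * s ^ 3 = - 4 * s\<^sup>2 * w x + 5 * s * (w x)\<^sup>2 - 5 / 6 * w x ^ 3"
        unfolding w_def by (simp add: field_simps power2_eq_square power3_eq_cube)
      thus ?thesis using k(2)[of x] by simp
    qed
    have "(u' has_real_derivative ((- 4 * s\<^sup>2 * w x + 5 * s * (w x)\<^sup>2 - 5 / 6 * w x ^ 3) * (w x)\<^sup>2
        + 2 * (K x)\<^sup>2 * w x) / (w x)\<^sup>2 ^ 2) (at x)"
      unfolding u'_def using w0[of x]
      by (auto intro!: derivative_eq_intros dK dw simp: power2_eq_square algebra_simps)
    moreover have "((- 4 * s\<^sup>2 * w x + 5 * s * (w x)\<^sup>2 - 5 / 6 * w x ^ 3) * (w x)\<^sup>2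
        + 2 * (K x)\<^sup>2 * w x) / (w x)\<^sup>2 ^ 2 = (2 * s)\<^sup>2 * u x"
      unfolding Kw u_def using w0[of x] \<open>s > 0\<close>
      by (simp add: field_simps power2_eq_square power3_eq_cube power4_eq_xxxx)
    ultimately show ?thesis by simp
  qed
  have en: "(u' x)\<^sup>2 = (2 * s)\<^sup>2 * ((u x)\<^sup>2 - A\<^sup>2)" for x
    unfolding u'_def power_divide Kw A2 u_def using w0[of x] \<open>s > 0\<close>
    by (simp add: field_simps power2_eq_square power4_eq_xxxx)
  from hyperbolic_ODE[OF du du' en] \<open>s > 0\<close> \<open>A > 0\<close>
  obtain x0 where x0: "(\<forall>x. u x = A * cosh (2 * s * (x - x0))) \<or> (\<forall>x. u x = - (A * cosh (2 * s * (x - x0))))"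
    by auto
  have wu: "1 / w x = u x + 5 / (12 * s)" for x by (simp add: u_def)
  \<comment> \<open>On this branch \<open>1 / w\<close> would change sign, because \<open>A < 5 / (12 * s)\<close>.\<close>
  have "\<not> (\<forall>x. u x = - (A * cosh (2 * s * (x - x0))))"
  proof
    assume neg: "\<forall>x. u x = - (A * cosh (2 * s * (x - x0)))"
    define v where "v x = 5 / (12 * s) - A * cosh (2 * s * (x - x0))" for x
    have v: "v x = 1 / w x" for x using neg wu by (simp add: v_def)
    have "A < 5 / (12 * s)"
    proof -
      have "A\<^sup>2 < (5 / (12 * s))\<^sup>2" unfolding A2 using \<open>s > 0\<close> by (simp add: field_simps power2_eq_square)
      thus ?thesis by (rule power2_less_imp_less) (use \<open>s > 0\<close> in simp)
    qed
    hence "v x0 > 0" by (simp add: v_def)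
    \<comment> \<open>Chosen so that exp t >= 1 + t, with t = 2 s (y - x0), already gives A cosh t
      >= 5/(12 s).\<close>
    define y where "y = x0 + 5 / (12 * s * A) / s"
    have "y \<ge> x0" using \<open>s > 0\<close> \<open>A > 0\<close> by (simp add: y_def)
    have "v y \<le> 0"
    proof -
      have "5 / (12 * s * A) \<le> exp (2 * s * (y - x0)) / 2"
      proof -
        have "2 * s * (y - x0) = 2 * (5 / (12 * s * A))" using \<open>s > 0\<close> by (simp add: y_def)
        thus ?thesis using exp_ge_add_one_self[of "2 * s * (y - x0)"] by linarith
      qed
      also have "\<dots> \<le> cosh (2 * s * (y - x0))" by (simp add: cosh_def)
      finally have "A * (5 / (12 * s * A)) \<le> A * cosh (2 * s * (y - x0))"
        using \<open>A > 0\<close> by (intro mult_left_mono) auto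
      thus ?thesis using \<open>A > 0\<close> by (simp add: v_def)
    qed
    moreover have "continuous_on {x0..y} v" unfolding v_def by (intro continuous_intros)
    ultimately obtain x where "v x = 0"
      using IVT2'[of v y 0 x0] \<open>v x0 > 0\<close> \<open>y \<ge> x0\<close> by auto
    thus False using v[of x] w0[of x] by simp
  qed
  hence pos: "u x = A * cosh (2 * s * (x - x0))" for x using x0 by blast
  have "k x = k_profile (s\<^sup>2) (x - x0)" for x
  proof -
    have "w x = 1 / (A * cosh (2 * s * (x - x0)) + 5 / (12 * s))"
      using wu[of x] pos[of x] w0[of x] by (metis divide_divide_eq_right div_by_1 mult_1)
    thus ?thesis using \<open>s > 0\<close> unfolding k_profile_def w_def A_def by simp
  qed
  thus ?thesis by blast
qed

subsection \<open>The soliton and its phase\<close>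

lemma k_profile_pos:
  assumes "B > 0"
  shows "k_profile B x > 0"
proof -
  have "0 < sqrt B / 2" using assms by simp
  thus ?thesis using k_profile_bounds(1)[OF assms] by (rule less_le_trans)
qed

lemma continuous_k_profile:
  assumes "B > 0"
  shows "continuous_on A (k_profile B)"
  unfolding k_profile_def
proof (intro continuous_intros ballI)
  fix y
  have "sqrt (5 / (72 * B)) * cosh (2 * sqrt B * y) > 0"
    using assms by (intro mult_pos_pos cosh_real_pos) auto
  moreover have "5 / (12 * sqrt B) > 0" using assms by simp
  ultimately show "sqrt (5 / (72 * B)) * cosh (2 * sqrt B * y) + 5 / (12 * sqrt B) \<noteq> 0"
    by linarith
qed

lemma theta_profile_shift: "theta_profile B \<theta>0 x = \<theta>0 + theta_profile B 0 x"
  by (simp add: theta_profile_def)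

text \<open>Splitting the tail integral at \<open>b\<close> turns increments of the phase into
  integrals over \<open>{a..b}\<close>, to which the fundamental theorem applies.\<close>

lemma theta_profile_deriv:
  assumes "B > 0"
  shows "(theta_profile B \<theta>0 has_real_derivative B / k_profile B x - k_profile B x / 4) (at x)"
proof -
  let ?f = "\<lambda>y. B / k_profile B y - k_profile B y / 4"
  have "theta_profile B \<theta>0 b - theta_profile B \<theta>0 a = integral {a..b} ?f" if "a \<le> b" for a b
  proof -
    note int = theta_profile_integrand_integrable[OF assms]
    have "set_integrable lebesgue {a..b} ?f" "set_integrable lebesgue {b..} ?f"
      using int[of a] int[of b] by (auto intro: set_integrable_subset)
    hence "(?f has_integral integral {a..b} ?f + integral {b..} ?f) ({a..b} \<union> {b..})"
      using that by (intro has_integral_Un integrable_integral set_lebesgue_integral_eq_integral(1))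
                    (auto intro!: negligible_subset[OF negligible_sing[of b]])
    moreover have "{a..b} \<union> {b..} = {a..}" using that by auto
    ultimately have "integral {a..} ?f = integral {a..b} ?f + integral {b..} ?f"
      by (simp add: integral_unique)
    thus ?thesis
      by (simp add: theta_profile_def set_lebesgue_integral_eq_integral(2)[OF int])
  qed
  moreover have "continuous_on UNIV ?f"
    using k_profile_pos[OF assms] continuous_k_profile[OF assms]
    by (intro continuous_intros) (auto simp: less_imp_neq[symmetric])
  ultimately show ?thesis
    unfolding has_real_derivative_iff_has_vector_derivative by (intro has_vector_derivative_if_integral)
qed

text \<open>Both sides have the same logarithmic derivative.\<close>

lemma polar_form:
  fixes \<phi> p :: "real \<Rightarrow> complex"
  assumes \<phi>: "\<And>x. (\<phi> has_vector_derivative p x) (at x)"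
    and k: "\<And>x. (k has_real_derivative K x) (at x)" "\<And>x. k x > 0" "\<And>x. k x = (cmod (\<phi> x))\<^sup>2"
    and \<theta>: "\<And>x. (\<theta> has_real_derivative \<theta>' x) (at x)"
    and p: "\<And>x. p x * of_real (k x) = \<phi> x * Complex (K x / 2) (k x * \<theta>' x)"
  shows "\<exists>\<theta>0. \<forall>x. \<phi> x = exp (\<i> * of_real (\<theta>0 + \<theta> x)) * of_real (sqrt (k x))"
proof -
  \<comment> \<open>The reciprocal of the expected polar form; it remains to see that the product
    with \<open>\<phi>\<close> is constant.\<close>
  define \<psi> where "\<psi> x = exp (- \<i> * of_real (\<theta> x)) * of_real (1 / sqrt (k x))" for x
  define \<psi>' where "\<psi>' x = - (\<psi> x * (\<i> * of_real (\<theta>' x) + of_real (K x / (2 * k x))))" for x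
  have d\<psi>: "(\<psi> has_vector_derivative \<psi>' x) (at x)" for x
  proof -
    have "((\<lambda>x. exp (- \<i> * of_real (\<theta> x))) has_vector_derivative
        (- \<i> * of_real (\<theta>' x)) * exp (- \<i> * of_real (\<theta> x))) (at x)"
    proof -
      have "((\<lambda>x. - \<i> * complex_of_real (\<theta> x)) has_vector_derivative (- \<i> * of_real (\<theta>' x))) (at x)"
        by (intro has_vector_derivative_mult_right has_vector_derivative_of_real \<theta>)
      from field_vector_diff_chain_at[OF this DERIV_exp] show ?thesis by (simp add: o_def)
    qed
    moreover have "((\<lambda>x. 1 / sqrt (k x)) has_real_derivative - (K x / (2 * k x)) / sqrt (k x)) (at x)"
    proof -
      have "((\<lambda>x. 1 / sqrt (k x)) has_real_derivative - (K x * (inverse (sqrt (k x)) / 2)) / (sqrt (k x) * sqrt (k x))) (at x)"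
        using k(2)[of x] by (auto intro!: derivative_eq_intros k)
      moreover have "sqrt (k x) * sqrt (k x) = k x" using k(2)[of x] by simp
      moreover have "- (c * (inverse r / 2)) / d = - (c / (2 * d)) / r" for c d r :: real
        by (simp add: divide_simps)
      ultimately show ?thesis by (simp only:)
    qed
    hence "((\<lambda>x. complex_of_real (1 / sqrt (k x))) has_vector_derivative of_real (- (K x / (2 * k x)) / sqrt (k x))) (at x)"
      by (rule has_vector_derivative_of_real)
    ultimately have "(\<psi> has_vector_derivative exp (- \<i> * of_real (\<theta> x)) * of_real (- (K x / (2 * k x)) / sqrt (k x))
       + ((- \<i> * of_real (\<theta>' x)) * exp (- \<i> * of_real (\<theta> x))) * of_real (1 / sqrt (k x))) (at x)"
      unfolding \<psi>_def by (rule has_vector_derivative_mult)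
    thus ?thesis by (simp add: \<psi>'_def \<psi>_def algebra_simps)
  qed
  have "((\<lambda>x. \<phi> x * \<psi> x) has_vector_derivative 0) (at x)" for x
  proof -
    have "p x = \<phi> x * (of_real (K x / (2 * k x)) + \<i> * of_real (\<theta>' x))"
    proof -
      have "Complex (K x / 2) (k x * \<theta>' x) = (of_real (K x / (2 * k x)) + \<i> * of_real (\<theta>' x)) * of_real (k x)"
        using k(2)[of x] by (simp add: complex_eq_iff)
      hence "p x * of_real (k x) = (\<phi> x * (of_real (K x / (2 * k x)) + \<i> * of_real (\<theta>' x))) * of_real (k x)"
        using p[of x] by (simp only: mult.assoc)
      thus ?thesis using k(2)[of x] by (simp only: mult_cancel_right of_real_eq_0_iff) simp
    qed
    hence "\<phi> x * \<psi>' x + p x * \<psi> x = 0" by (simp add: \<psi>'_def algebra_simps)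
    thus ?thesis using has_vector_derivative_mult[OF \<phi>[of x] d\<psi>[of x]] by simp
  qed
  hence "\<exists>c. \<forall>x. \<phi> x * \<psi> x = c"
    using has_derivative_zero_constant[of UNIV "\<lambda>x. \<phi> x * \<psi> x"]
    by (auto simp: has_vector_derivative_def)
  then obtain c where c: "\<phi> x * \<psi> x = c" for x by blast
  \<comment> \<open>The constant has modulus one, so it is a pure phase, and its argument becomes
    the free constant of the theorem.\<close>
  have "cmod (\<phi> 0) = sqrt (k 0)" by (simp add: k(3))
  moreover have "cmod (\<psi> 0) = 1 / sqrt (k 0)"
    using k(2)[of 0] unfolding \<psi>_def norm_mult norm_of_real by (simp add: norm_exp_eq_Re)
  ultimately have "cmod c = 1"
    using k(2)[of 0] unfolding c[of 0, symmetric] norm_mult by simp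
  then obtain t where t: "c = exp (\<i> * of_real t)"
    by (metis cis_conv_exp complex_norm_eq_1_exp mult.commute)
  have "\<phi> x = exp (\<i> * of_real (t + \<theta> x)) * of_real (sqrt (k x))" for x
  proof -
    have inv: "exp (\<i> * of_real (\<theta> x)) * of_real (sqrt (k x)) * \<psi> x = 1"
      using k(2)[of x] by (simp add: \<psi>_def exp_minus)
    have "\<phi> x = (\<phi> x * \<psi> x) * (exp (\<i> * of_real (\<theta> x)) * of_real (sqrt (k x)))"
      using inv by (simp add: mult_ac)
    thus ?thesis unfolding c t by (simp add: exp_add distrib_left)
  qed
  thus ?thesis by blast
qed

theorem theorem1p6:
  fixes \<phi> :: "real \<Rightarrow> complex"
  assumes "stationary_solution \<phi>"
  shows "(\<not> \<phi> constant_on UNIV \<and> (INF x. norm (\<phi> x)) > 0 \<longrightarrow>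
            (\<exists>\<theta>0 B x0. B > 0 \<and>
               (\<forall>x. \<phi> x = exp (\<i> * complex_of_real (theta_profile B \<theta>0 (x - x0))) *
                            complex_of_real (sqrt (k_profile B (x - x0)))))) \<and>
         ((\<phi> \<longlongrightarrow> 0) at_top \<longrightarrow> (\<forall>x. \<phi> x = 0))"
proof -

  \<comment> \<open>Regularity and first integrals of the given solution\<close>
  from assms obtain \<phi>x \<phi>xx v where w: "has_weak_derivative \<phi> \<phi>x" "has_weak_derivative \<phi>x \<phi>xx"
      "AE x in lebesgue. \<phi>xx x + \<i> * (\<phi> x)\<^sup>2 * cnj (\<phi>x x) = 0"
    and cont: "continuous_on UNIV \<phi>" and Linf: "\<phi> \<in> Linf_space"
    and v: "v \<in> L2_space" "has_weak_derivative \<phi> v"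
    by (auto simp: stationary_solution_def zhidkov_def numeral_2_eq_2)
  \<comment> \<open>The weak derivative \<open>v\<close> known to be square integrable and the
    \<open>\<phi>x\<close> of the equation are separate witnesses; \<open>vp\<close> identifies
    \<open>v\<close> with the classical derivative.\<close>
  obtain p where \<phi>: "\<And>x. (\<phi> has_vector_derivative p x) (at x)"
    and p: "\<And>x. (p has_vector_derivative - \<i> * (\<phi> x)\<^sup>2 * cnj (p x)) (at x)"
    and vp: "AE x in lebesgue. v x = p x"
    using stationary_C2[OF w(1,2) cont w(3)] v(2) by metis
  define k where "k x = (cmod (\<phi> x))\<^sup>2" for x
  obtain K B E0 where dk: "\<And>x. (k has_real_derivative K x) (at x)"
    and dK: "\<And>x. (K has_real_derivative 5 / 6 * k x ^ 3 - 6 * B * k x + 2 * E0) (at x)"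
    and K: "\<And>x. (K x)\<^sup>2 = 5 / 12 * k x ^ 4 - 6 * B * (k x)\<^sup>2 + 4 * E0 * k x - 4 * B\<^sup>2"
    and E: "\<And>x. (cmod (p x))\<^sup>2 = k x ^ 3 / 6 - 2 * B * k x + E0"
    and J: "\<And>x. (B - (k x)\<^sup>2 / 4)\<^sup>2 \<le> k x * (cmod (p x))\<^sup>2"
    and pk: "\<And>x. p x * of_real (k x) = \<phi> x * Complex (K x / 2) (B - (k x)\<^sup>2 / 4)"
    unfolding k_def by (rule stationary_first_integrals[OF \<phi> p]) blast
  obtain C where C: "\<And>x. cmod (\<phi> x) \<le> C" using continuous_Linf_bounded[OF cont Linf] by blast
  have kC: "\<bar>k x\<bar> \<le> C\<^sup>2" for x unfolding k_def using C[of x] by (simp add: power_mono)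
  have "continuous_on UNIV p"
    using p by (meson continuous_at_imp_continuous_on has_vector_derivative_continuous)
  hence pm: "p \<in> borel_measurable lebesgue"
    using continuous_imp_measurable_on_sets_lebesgue[of UNIV p] by (simp add: lebesgue_on_UNIV_eq)

  \<comment> \<open>A sequence along which the derivative vanishes\<close>
  have "integrable lebesgue (\<lambda>x. (cmod (p x))\<^sup>2)"
  proof (rule integrable_cong_AE_imp)
    show "integrable lebesgue (\<lambda>x. (cmod (v x))\<^sup>2)" using v(1) by (simp add: L2_space_def)
    show "(\<lambda>x. (cmod (p x))\<^sup>2) \<in> borel_measurable lebesgue" by (intro borel_measurable_power measurable_compose[OF pm] borel_measurable_norm)
    show "AE x in lebesgue. (cmod (v x))\<^sup>2 = (cmod (p x))\<^sup>2" using vp by eventually_elim simp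
  qed
  hence "\<exists>x\<ge>real n. (cmod (p x))\<^sup>2 < inverse (real (Suc n))" for n
    by (rule integrable_ex_small) simp
  then obtain X where X: "\<And>n. X n \<ge> real n" "\<And>n. (cmod (p (X n)))\<^sup>2 < inverse (real (Suc n))" by metis
  have X_top: "filterlim X at_top sequentially"
    by (rule filterlim_at_top_mono[OF filterlim_real_sequentially]) (simp add: X)
  have EX: "(\<lambda>n. (cmod (p (X n)))\<^sup>2) \<longlonglongrightarrow> 0"
    by (rule tendsto_sandwich[OF _ _ tendsto_const LIMSEQ_inverse_real_of_nat])
       (use X(2) in \<open>auto intro!: always_eventually intro: less_imp_le simp del: of_nat_Suc\<close>)
  \<comment> \<open>Since \<open>k\<close> is bounded, J^2 is at most a constant times
    |p|^2.\<close>
  have "(\<lambda>n. (B - (k (X n))\<^sup>2 / 4)\<^sup>2) \<longlonglongrightarrow> 0"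
  proof (rule tendsto_sandwich[OF _ _ tendsto_const])
    show "(\<lambda>n. C\<^sup>2 * (cmod (p (X n)))\<^sup>2) \<longlonglongrightarrow> 0" using tendsto_mult_right_zero[OF EX] .
    have "(B - (k x)\<^sup>2 / 4)\<^sup>2 \<le> C\<^sup>2 * (cmod (p x))\<^sup>2" for x
      using kC[of x] by (intro order_trans[OF J] mult_right_mono) auto
    thus "\<forall>\<^sub>F n in sequentially. (B - (k (X n))\<^sup>2 / 4)\<^sup>2 \<le> C\<^sup>2 * (cmod (p (X n)))\<^sup>2" by simp
  qed simp
  hence JX: "(\<lambda>n. B - (k (X n))\<^sup>2 / 4) \<longlonglongrightarrow> 0" by (simp add: power_tendsto_0_iff)
  have EX': "(\<lambda>n. k (X n) ^ 3 / 6 - 2 * B * k (X n) + E0) \<longlonglongrightarrow> 0" using EX by (simp add: E)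

  \<comment> \<open>Solutions bounded away from zero\<close>
  have "\<exists>\<theta>0 B x0. B > 0 \<and> (\<forall>x. \<phi> x = exp (\<i> * complex_of_real (theta_profile B \<theta>0 (x - x0))) *
                            complex_of_real (sqrt (k_profile B (x - x0))))"
    if nc: "\<not> \<phi> constant_on UNIV" and INF: "(INF x. norm (\<phi> x)) > 0"
  proof -
    define m where "m = (INF x. norm (\<phi> x))"
    have "m > 0" using INF by (simp add: m_def)
    have "m \<le> cmod (\<phi> x)" for x
      unfolding m_def by (rule cINF_lower) (auto intro!: bdd_belowI[of _ 0])
    hence km: "m\<^sup>2 \<le> k x" for x using \<open>m > 0\<close> by (simp add: k_def power_mono)
    have k0: "k x > 0" for x using km[of x] \<open>m > 0\<close> by (meson less_le_trans zero_less_power)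
    \<comment> \<open>Along the sequence k^2 tends to 4 B, and the lower bound m^4 on k^2 makes
      \<open>B\<close> positive.\<close>
    have "(\<lambda>n. 4 * (B - (B - (k (X n))\<^sup>2 / 4))) \<longlonglongrightarrow> 4 * (B - 0)" by (intro tendsto_intros JX)
    hence k2: "(\<lambda>n. (k (X n))\<^sup>2) \<longlonglongrightarrow> 4 * B" by simp
    have "(m\<^sup>2)\<^sup>2 \<le> (k x)\<^sup>2" for x by (intro power_mono km) simp
    hence "(m\<^sup>2)\<^sup>2 \<le> 4 * B"
      by (intro tendsto_lowerbound[OF k2] always_eventually) auto
    moreover have "(m\<^sup>2)\<^sup>2 > 0" using \<open>m > 0\<close> by simp
    ultimately have "B > 0" by linarith
    define s where "s = sqrt B"
    have s: "s > 0" "B = s\<^sup>2" using \<open>B > 0\<close> by (auto simp: s_def)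
    have "(\<lambda>n. sqrt ((k (X n))\<^sup>2)) \<longlonglongrightarrow> sqrt (4 * B)" by (rule tendsto_real_sqrt[OF k2])
    moreover have "sqrt (4 * B) = 2 * s" by (simp add: real_sqrt_mult s_def)
    ultimately have kX: "(\<lambda>n. k (X n)) \<longlonglongrightarrow> 2 * s" using k0 by (simp add: less_imp_le)
    have "(\<lambda>n. k (X n) ^ 3 / 6 - 2 * B * k (X n) + E0) \<longlonglongrightarrow> (2 * s) ^ 3 / 6 - 2 * B * (2 * s) + E0"
      by (intro tendsto_intros kX) simp
    \<comment> \<open>With k tending to 2 s, the limit reads (4/3) s^3 - 4 s^3 + E0 = 0.\<close>
    from LIMSEQ_unique[OF this EX'] have E0: "E0 = 8 / 3 * s ^ 3"
      unfolding s(2) by (simp add: power2_eq_square power3_eq_cube)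
    \<comment> \<open>If \<open>k\<close> were identically 2 s, the formula for |p|^2 would vanish
      and \<open>\<phi>\<close> would be constant.\<close>
    have "\<exists>x1. k x1 \<noteq> 2 * s"
    proof (rule ccontr)
      assume "\<not> ?thesis"
      hence k_const: "k x = 2 * s" for x by simp
      have "p x = 0" for x
      proof -
        have "(cmod (p x))\<^sup>2 = 0" unfolding E k_const E0 s(2) by (simp add: power2_eq_square power3_eq_cube)
        thus ?thesis by simp
      qed
      hence "\<exists>c. \<forall>x. \<phi> x = c"
        using has_derivative_zero_constant[of UNIV \<phi>] \<phi> by (auto simp: has_vector_derivative_def)
      thus False using nc by (auto simp: constant_on_def)
    qed
    then obtain x1 where "k x1 \<noteq> 2 * s" by blast
    moreover have "(K has_real_derivative 5 / 6 * k x ^ 3 - 6 * s\<^sup>2 * k x + 16 / 3 * s ^ 3) (at x)" for x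
      using dK[of x] by (simp add: E0 s(2))
    moreover have "(K x)\<^sup>2 = 5 / 12 * k x ^ 4 - 6 * s\<^sup>2 * (k x)\<^sup>2 + 32 / 3 * s ^ 3 * k x - 4 * s ^ 4" for x
      unfolding K by (simp add: E0 s(2) flip: power_mult)
    ultimately obtain x0 where x0: "k x = k_profile B (x - x0)" for x
      using dark_soliton_profile[OF dk _ _ \<open>s > 0\<close> kC] unfolding s(2) by blast
    have d\<theta>: "((\<lambda>x. theta_profile B 0 (x - x0)) has_real_derivative B / k x - k x / 4) (at x)" for x
      using DERIV_shift[of "theta_profile B 0" _ x "- x0"] theta_profile_deriv[OF \<open>B > 0\<close>, of 0 "x - x0"]
      by (simp add: x0)
    \<comment> \<open>Factoring B - k^2/4 as k (B/k - k/4) identifies the phase derivative with the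
      integrand of \<open>theta_profile\<close>.\<close>
    have "p x * of_real (k x) = \<phi> x * Complex (K x / 2) (k x * (B / k x - k x / 4))" for x
      using pk[of x] k0[of x] by (simp add: right_diff_distrib power2_eq_square)
    from polar_form[OF \<phi> dk k0 k_def d\<theta> this]
    obtain \<theta>0 where "\<forall>x. \<phi> x = exp (\<i> * of_real (\<theta>0 + theta_profile B 0 (x - x0))) * of_real (sqrt (k x))"
      by blast
    hence "\<forall>x. \<phi> x = exp (\<i> * complex_of_real (theta_profile B \<theta>0 (x - x0))) *
                            complex_of_real (sqrt (k_profile B (x - x0)))"
      unfolding x0 by (subst theta_profile_shift)
    thus ?thesis using \<open>B > 0\<close> by blast
  qed

  \<comment> \<open>Solutions vanishing at infinity\<close>
  moreover have "\<phi> x = 0" if "(\<phi> \<longlongrightarrow> 0) at_top" for x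
  proof -
    have "(\<lambda>n. \<phi> (X n)) \<longlonglongrightarrow> 0" using filterlim_compose[OF that X_top] .
    hence "(\<lambda>n. (cmod (\<phi> (X n)))\<^sup>2) \<longlonglongrightarrow> (cmod 0)\<^sup>2" by (intro tendsto_intros)
    hence kX: "(\<lambda>n. k (X n)) \<longlonglongrightarrow> 0" by (simp add: k_def)
    have "(\<lambda>n. B - (k (X n))\<^sup>2 / 4) \<longlonglongrightarrow> B - 0\<^sup>2 / 4" by (intro tendsto_intros kX) simp
    from LIMSEQ_unique[OF this JX] have B: "B = 0" by simp
    have "(\<lambda>n. k (X n) ^ 3 / 6 - 2 * B * k (X n) + E0) \<longlonglongrightarrow> 0 ^ 3 / 6 - 2 * B * 0 + E0"
      by (intro tendsto_intros kX) simp
    from LIMSEQ_unique[OF this EX'] have E0: "E0 = 0" by simp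
    have "k x = 0"
      by (rule zero_profile[OF dk]) (use dK K kC in \<open>simp_all add: B E0\<close>)
    thus ?thesis by (simp add: k_def)
  qed
  ultimately show ?thesis by blast
qed

end
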